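(* Let $N$ be a closed connected manifold and let $X,X'\subset T^*N$ be two superheavy subsets. Then $X\cap X'\ne\varnothing$.
   Context: Let $N$ be a closed connected manifold of dimension $n$ with a fixed auxiliary Riemannian metric; homology has $\mathbb{Z}_2$ coefficients. $T^*N$ carries $\lambda=p\,dq$ and $\omega=d\lambda$; $N$ also denotes the zero section and $\pi:T^*N\to N$ the projection. For $H:[0,1]\times T^*N\to\mathbb{R}$, $H_t=H(t,\cdot)$, $X_H$ is defined by $\omega(X_H,\cdot)=-dH_t$, with flow $\phi_H^t$ and $\phi_H=\phi_H^1$. $\mathcal{G}$ is the group of time-$1$ maps of compactly supported Hamiltonians. Lagrangian spectral invariants. Let $\Omega(N)$ be the space of paths $\gamma:[0,1]\to T^*N$ with $\gamma(0),\gamma(1)\in N$, and $\mathcal{A}_H(\gamma)=\int_0^1H_t(\gamma(t))\,dt-\int\gamma^*\lambda$ for $H\in C_c^\infty([0,1]\times T^*N)$. Critical points of $\mathcal{A}_H$ on $\Omega(N)$ are the solutions of $\dot\gamma=X_H(\gamma)$ in $\Omega(N)$. If $\phi_H(N)$ is transverse to $N$, let $CF_*(H:N)$ be the $\mathbb{Z}_2$-vector space spanned by these critical points, graded by the Conley–Zehnder index normalized so that for $H=\pi^*f$ with $f$ Morse on $N$ it is the Morse index of $f$. For a generic path $J_t$ of almost complex structures with $\omega(\cdot,J_t\cdot)$ Riemannian, equal outside a compact set to the one induced by the metric on $N$, the differential counts mod $2$ (modulo $\mathbb{R}$-translation) solutions $u:\mathbb{R}\times[0,1]\to T^*N$ of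 $\partial_su+J_t(u)(\partial_tu-X_H(u))=0$ with $u(s,0),u(s,1)\in N$, running from $\gamma_-$ ($s\to-\infty$) to $\gamma_+$ ($s\to+\infty$), index difference $1$. Its homology is canonically isomorphic to $H_*(N)$. For $\alpha\in H_*(N)\setminus\{0\}$, $\ell(\alpha,H)$ is the infimum of those $a$ for which $\alpha$ is in the image of the homology of the subcomplex spanned by critical points of action $<a$. By $C^0$-continuity $\ell(\alpha,\cdot)$ extends to all $H\in C_c^\infty([0,1]\times T^*N)$; it depends only on $\phi_H$, and one writes $\ell(\alpha,\phi_H)$. Put $\ell_+=\ell([N],\cdot)$. For $\phi\in\mathcal{G}$, $\mu_0(\phi)=\lim_{k\to\infty}\ell_+(\phi^k)/k$; for $f\in C_c^\infty(T^*N)$, $\zeta(f)=\mu_0(\phi_f)$. A compact subset $X\subset T^*N$ is superheavy if for any $f\in C_c^\infty(T^*N)$ with $f|_X=c\in\mathbb{R}$ we have $\zeta(f)=c$. *)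

theory Defs
  imports "HOL-Analysis.Analysis" "HOL-Homology.Homology" "HOL-Library.Z2" "HOL-Library.Set_Algebras" "HOL-Library.Poly_Mapping"
begin

section \<open>Smooth manifolds given by atlases\<close>

text \<open>
  Directional derivatives are applied from the head of the list on; \<open>S\<close> is open, or a product of
  \<open>{0..1}\<close> with an open set, so that derivatives within \<open>S\<close> are unique.
\<close>

primrec iter_deriv :: "'v::real_normed_vector set \<Rightarrow> 'v list \<Rightarrow> ('v \<Rightarrow> 'w::real_normed_vector) \<Rightarrow> 'v \<Rightarrow> 'w"
  where
    "iter_deriv S [] f = f"
  | "iter_deriv S (v # vs) f = iter_deriv S vs (\<lambda>z. frechet_derivative f (at z within S) v)"

text \<open>On a set that is not open, smooth means: extends smoothly to an open neighbourhood.\<close>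

definition smooth_on :: "'v::real_normed_vector set \<Rightarrow> ('v \<Rightarrow> 'w::real_normed_vector) \<Rightarrow> bool"
  where "smooth_on S f \<longleftrightarrow>
    (\<exists>U F. open U \<and> S \<subseteq> U \<and> (\<forall>x\<in>S. F x = f x) \<and> (\<forall>vs. iter_deriv U vs F differentiable_on U))"

type_synonym ('m, 'e) chart = "'m set \<times> ('m \<Rightarrow> 'e)"

abbreviation cimg :: "('m, 'e) chart \<Rightarrow> 'e set"
  where "cimg c \<equiv> snd c ` fst c"

abbreviation cinv :: "('m, 'e) chart \<Rightarrow> 'e \<Rightarrow> 'm"
  where "cinv c \<equiv> inv_into (fst c) (snd c)"

definition carrier_of :: "('m, 'e) chart set \<Rightarrow> 'm set"
  where "carrier_of A = (\<Union>c\<in>A. fst c)"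

definition smooth_atlas :: "('m, 'e::euclidean_space) chart set \<Rightarrow> bool"
  where "smooth_atlas A \<longleftrightarrow>
    (\<forall>c\<in>A. inj_on (snd c) (fst c) \<and> open (cimg c)) \<and>
    (\<forall>c\<in>A. \<forall>d\<in>A. open (snd c ` (fst c \<inter> fst d)) \<and>
       smooth_on (snd c ` (fst c \<inter> fst d)) (snd d \<circ> cinv c))"

definition mtop :: "('m, 'e::euclidean_space) chart set \<Rightarrow> 'm topology"
  where "mtop A = topology (\<lambda>U. U \<subseteq> carrier_of A \<and> (\<forall>c\<in>A. open (snd c ` (U \<inter> fst c))))"

definition closed_connected_manifold :: "('m, 'e::euclidean_space) chart set \<Rightarrow> bool"
  where "closed_connected_manifold A \<longleftrightarrow>
    smooth_atlas A \<and> carrier_of A \<noteq> {} \<and>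
    Hausdorff_space (mtop A) \<and> compact_space (mtop A) \<and> connected_space (mtop A)"

definition dtrans :: "('m, 'e::euclidean_space) chart \<Rightarrow> ('m, 'e) chart \<Rightarrow> 'm \<Rightarrow> 'e \<Rightarrow> 'e"
  where "dtrans c d x = frechet_derivative (snd d \<circ> cinv c) (at (snd c x))"

definition smooth_fun :: "('m, 'e::euclidean_space) chart set \<Rightarrow> ('m \<Rightarrow> real) \<Rightarrow> bool"
  where "smooth_fun A f \<longleftrightarrow> (\<forall>c\<in>A. smooth_on (cimg c) (f \<circ> cinv c))"

definition smooth_into ::
    "('m, 'e::euclidean_space) chart set \<Rightarrow> 'v::real_normed_vector set \<Rightarrow> ('v \<Rightarrow> 'm) \<Rightarrow> bool"
  where "smooth_into A S u \<longleftrightarrow>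
    continuous_map (top_of_set S) (mtop A) u \<and>
    (\<forall>c\<in>A. smooth_on {z \<in> S. u z \<in> fst c} (snd c \<circ> u))"

text \<open>A metric is given by its local expressions \<open>g c x\<close>, where \<open>x \<in> cimg c\<close>.\<close>

definition riemannian_metric ::
    "('m, 'e::euclidean_space) chart set \<Rightarrow> (('m, 'e) chart \<Rightarrow> 'e \<Rightarrow> 'e \<Rightarrow> 'e \<Rightarrow> real) \<Rightarrow> bool"
  where "riemannian_metric A g \<longleftrightarrow>
    (\<forall>c\<in>A.
       (\<forall>x\<in>cimg c. (\<forall>v. linear (g c x v)) \<and> (\<forall>v w. g c x v w = g c x w v) \<and>
          (\<forall>v. v \<noteq> 0 \<longrightarrow> g c x v v > 0)) \<and>
       (\<forall>v w. smooth_on (cimg c) (\<lambda>x. g c x v w)) \<and>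
       (\<forall>d\<in>A. \<forall>q\<in>fst c \<inter> fst d. \<forall>v w.
          g c (snd c q) v w = g d (snd d q) (dtrans c d q v) (dtrans c d q w)))"


section \<open>The cotangent bundle\<close>

text \<open>
  A covector at \<open>q\<close> is the family of its coordinate expressions in the charts around \<open>q\<close>
  (and \<open>0\<close> at all other arguments). In the chart of \<open>T\<^sup>*N\<close> induced by a chart of \<open>N\<close>, a point has
  coordinates \<open>(q, p)\<close>, and tangent vectors are pairs of a \<open>q\<close>- and a \<open>p\<close>-component.
\<close>

type_synonym ('m, 'n) base_chart = "('m, (real, 'n) vec) chart"
type_synonym ('m, 'n) cotpoint = "'m \<times> (('m, 'n) base_chart \<Rightarrow> (real, 'n) vec)"
type_synonym 'n phase = "(real, 'n) vec \<times> (real, 'n) vec"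
type_synonym ('m, 'n) cot_chart = "(('m, 'n) cotpoint, 'n phase) chart"

definition cotangent :: "('m, 'n::finite) base_chart set \<Rightarrow> ('m, 'n) cotpoint set"
  where "cotangent A = {(q, \<xi>). q \<in> carrier_of A \<and>
    (\<forall>c. \<not> (c \<in> A \<and> q \<in> fst c) \<longrightarrow> \<xi> c = 0) \<and>
    (\<forall>c\<in>A. \<forall>d\<in>A. q \<in> fst c \<inter> fst d \<longrightarrow> (\<forall>v. \<xi> c \<bullet> v = \<xi> d \<bullet> dtrans c d q v))}"

definition cot_atlas :: "('m, 'n::finite) base_chart set \<Rightarrow> ('m, 'n) cot_chart set"
  where "cot_atlas A =
    (\<lambda>c. ({x \<in> cotangent A. fst x \<in> fst c}, \<lambda>x. (snd c (fst x), snd x c))) ` A"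

definition zero_section :: "('m, 'n::finite) base_chart set \<Rightarrow> ('m, 'n) cotpoint set"
  where "zero_section A = {x \<in> cotangent A. \<forall>c. snd x c = 0}"

text \<open>\<open>\<lambda> = p dq\<close>; differentiating \<open>liouville z w\<close> in \<open>z\<close> gives \<open>d\<lambda> = \<Sum>\<^sub>i dp\<^sub>i \<and> dq\<^sub>i\<close>.\<close>

definition liouville :: "'n::finite phase \<Rightarrow> 'n phase \<Rightarrow> real"
  where "liouville z v = snd z \<bullet> fst v"

definition omega :: "'n::finite phase \<Rightarrow> 'n phase \<Rightarrow> real"
  where "omega v w = snd v \<bullet> fst w - snd w \<bullet> fst v"


section \<open>Hamiltonian dynamics\<close>

text \<open>Only the values of a Hamiltonian on \<open>[0,1] \<times> T\<^sup>*N\<close> are relevant.\<close>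

definition compact_hamiltonian ::
    "('m, 'n::finite) base_chart set \<Rightarrow> (real \<Rightarrow> ('m, 'n) cotpoint \<Rightarrow> real) \<Rightarrow> bool"
  where "compact_hamiltonian A H \<longleftrightarrow>
    (\<forall>C\<in>cot_atlas A. smooth_on ({0..1} \<times> cimg C) (\<lambda>(t, z). H t (cinv C z))) \<and>
    (\<exists>K. compactin (mtop (cot_atlas A)) K \<and> (\<forall>t\<in>{0..1}. \<forall>x\<in>cotangent A - K. H t x = 0))"

definition compact_function :: "('m, 'n::finite) base_chart set \<Rightarrow> (('m, 'n) cotpoint \<Rightarrow> real) \<Rightarrow> bool"
  where "compact_function A f \<longleftrightarrow>
    smooth_fun (cot_atlas A) f \<and>
    (\<exists>K. compactin (mtop (cot_atlas A)) K \<and> (\<forall>x\<in>cotangent A - K. f x = 0))"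

definition ham_field :: "(('m, 'n::finite) cotpoint \<Rightarrow> real) \<Rightarrow> ('m, 'n) cot_chart \<Rightarrow> 'n phase \<Rightarrow> 'n phase"
  where "ham_field h C z = (THE X. \<forall>Y. omega X Y = - frechet_derivative (h \<circ> cinv C) (at z) Y)"

definition ham_traj ::
    "('m, 'n::finite) base_chart set \<Rightarrow> (real \<Rightarrow> ('m, 'n) cotpoint \<Rightarrow> real) \<Rightarrow> (real \<Rightarrow> ('m, 'n) cotpoint) \<Rightarrow> bool"
  where "ham_traj A H \<gamma> \<longleftrightarrow>
    smooth_into (cot_atlas A) {0..1} \<gamma> \<and>
    (\<forall>t\<in>{0..1}. \<forall>C\<in>cot_atlas A. \<gamma> t \<in> fst C \<longrightarrow>
       ((snd C \<circ> \<gamma>) has_vector_derivative ham_field (H t) C (snd C (\<gamma> t))) (at t within {0..1}))"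

definition ham_flow ::
    "('m, 'n::finite) base_chart set \<Rightarrow> (real \<Rightarrow> ('m, 'n) cotpoint \<Rightarrow> real) \<Rightarrow> real \<Rightarrow> ('m, 'n) cotpoint \<Rightarrow> ('m, 'n) cotpoint"
  where "ham_flow A H t x = (THE y. \<exists>\<gamma>. ham_traj A H \<gamma> \<and> \<gamma> 0 = x \<and> \<gamma> t = y)"

text \<open>The differential of the time-\<open>t\<close> flow at \<open>x\<close> in charts \<open>C\<close> around \<open>x\<close> and \<open>D\<close> around its image.\<close>

definition dflow ::
    "('m, 'n::finite) base_chart set \<Rightarrow> (real \<Rightarrow> ('m, 'n) cotpoint \<Rightarrow> real) \<Rightarrow> real \<Rightarrow>
      ('m, 'n) cot_chart \<Rightarrow> ('m, 'n) cot_chart \<Rightarrow> ('m, 'n) cotpoint \<Rightarrow> 'n phase \<Rightarrow> 'n phase"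
  where "dflow A H t C D x = frechet_derivative (snd D \<circ> ham_flow A H t \<circ> cinv C) (at (snd C x))"

text \<open>
  \<open>\<phi>\<^sub>H(N)\<close> is transverse to \<open>N\<close>. In charts of \<open>T\<^sup>*N\<close> the vectors tangent to \<open>N\<close> are those
  with vanishing \<open>p\<close>-component.
\<close>

definition transversal_end ::
    "('m, 'n::finite) base_chart set \<Rightarrow> (real \<Rightarrow> ('m, 'n) cotpoint \<Rightarrow> real) \<Rightarrow> bool"
  where "transversal_end A H \<longleftrightarrow>
    (\<forall>x\<in>zero_section A. ham_flow A H 1 x \<in> zero_section A \<longrightarrow>
       (\<forall>C\<in>cot_atlas A. \<forall>D\<in>cot_atlas A. x \<in> fst C \<longrightarrow> ham_flow A H 1 x \<in> fst D \<longrightarrow>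
          (\<forall>w. \<exists>a b. w = dflow A H 1 C D x (a, 0) + (b, 0))))"

text \<open>Paths are functions on \<open>[0,1]\<close>, hence extensional.\<close>

definition crit_paths ::
    "('m, 'n::finite) base_chart set \<Rightarrow> (real \<Rightarrow> ('m, 'n) cotpoint \<Rightarrow> real) \<Rightarrow> (real \<Rightarrow> ('m, 'n) cotpoint) set"
  where "crit_paths A H =
    {\<gamma> \<in> extensional {0..1}. ham_traj A H \<gamma> \<and> \<gamma> 0 \<in> zero_section A \<and> \<gamma> 1 \<in> zero_section A}"

definition liouville_along ::
    "('m, 'n::finite) base_chart set \<Rightarrow> (real \<Rightarrow> ('m, 'n) cotpoint) \<Rightarrow> real \<Rightarrow> real"
  where "liouville_along A \<gamma> t = (THE r. \<forall>C\<in>cot_atlas A. \<gamma> t \<in> fst C \<longrightarrow>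
    r = liouville (snd C (\<gamma> t)) (vector_derivative (snd C \<circ> \<gamma>) (at t within {0..1})))"

definition action ::
    "('m, 'n::finite) base_chart set \<Rightarrow> (real \<Rightarrow> ('m, 'n) cotpoint \<Rightarrow> real) \<Rightarrow> (real \<Rightarrow> ('m, 'n) cotpoint) \<Rightarrow> real"
  where "action A H \<gamma> =
    integral {0..1} (\<lambda>t. H t (\<gamma> t)) - integral {0..1} (liouville_along A \<gamma>)"


section \<open>The Conley--Zehnder index\<close>

text \<open>
  A symplectic trivialization \<open>\<real>\<^sup>2\<^sup>n \<rightarrow> T\<^bsub>\<gamma>(t)\<^esub>T\<^sup>*N\<close> along \<open>\<gamma>\<close> (given by its expressions in charts)
  which respects the vertical distribution, and the zero section at both ends.
\<close>

definition vertical_trivialization ::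
    "('m, 'n::finite) base_chart set \<Rightarrow> (real \<Rightarrow> ('m, 'n) cotpoint) \<Rightarrow>
      (real \<Rightarrow> ('m, 'n) cot_chart \<Rightarrow> 'n phase \<Rightarrow> 'n phase) \<Rightarrow> bool"
  where "vertical_trivialization A \<gamma> \<Psi> \<longleftrightarrow>
    (\<forall>C\<in>cot_atlas A.
       (\<forall>t\<in>{0..1}. \<gamma> t \<in> fst C \<longrightarrow>
          linear (\<Psi> t C) \<and> (\<forall>v w. omega (\<Psi> t C v) (\<Psi> t C w) = omega v w) \<and>
          (\<forall>b. fst (\<Psi> t C (0, b)) = 0) \<and>
          (t \<in> {0, 1} \<longrightarrow> (\<forall>a. snd (\<Psi> t C (a, 0)) = 0)) \<and>
          (\<forall>D\<in>cot_atlas A. \<gamma> t \<in> fst D \<longrightarrow> (\<forall>v. \<Psi> t D v = dtrans C D (\<gamma> t) (\<Psi> t C v)))) \<and>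
       (\<forall>v. continuous_on {t \<in> {0..1}. \<gamma> t \<in> fst C} (\<lambda>t. \<Psi> t C v)))"

definition trivialized_dflow ::
    "('m, 'n::finite) base_chart set \<Rightarrow> (real \<Rightarrow> ('m, 'n) cotpoint \<Rightarrow> real) \<Rightarrow> (real \<Rightarrow> ('m, 'n) cotpoint) \<Rightarrow>
      (real \<Rightarrow> ('m, 'n) cot_chart \<Rightarrow> 'n phase \<Rightarrow> 'n phase) \<Rightarrow> real \<Rightarrow> 'n phase \<Rightarrow> 'n phase"
  where "trivialized_dflow A H \<gamma> \<Psi> t v =
    (THE w. \<forall>C\<in>cot_atlas A. \<forall>D\<in>cot_atlas A. \<gamma> 0 \<in> fst C \<longrightarrow> \<gamma> t \<in> fst D \<longrightarrow>
       \<Psi> t D w = dflow A H t C D (\<gamma> 0) (\<Psi> 0 C v))"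

text \<open>
  For \<open>t \<in> [0,1]\<close> the columns of \<open>lagrangian_frame A H \<gamma> \<Psi> t\<close>, with \<open>\<real>\<^sup>2\<^sup>n\<close> identified with \<open>\<complex>\<^sup>n\<close>
  by \<open>(x, y) \<mapsto> x + \<i> y\<close>, span the trivialized image of \<open>T\<^bsub>\<gamma>(0)\<^esub>N\<close> under the linearized flow. At time
  \<open>1\<close> this Lagrangian subspace is transverse to \<open>\<real>\<^sup>n \<times> 0\<close>; for \<open>t \<in> [1,2]\<close> it is rotated into
  \<open>0 \<times> \<real>\<^sup>n\<close> through subspaces transverse to \<open>\<real>\<^sup>n \<times> 0\<close>.
\<close>

definition lagrangian_frame ::
    "('m, 'n::finite) base_chart set \<Rightarrow> (real \<Rightarrow> ('m, 'n) cotpoint \<Rightarrow> real) \<Rightarrow> (real \<Rightarrow> ('m, 'n) cotpoint) \<Rightarrow>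
      (real \<Rightarrow> ('m, 'n) cot_chart \<Rightarrow> 'n phase \<Rightarrow> 'n phase) \<Rightarrow> real \<Rightarrow> complex ^ 'n ^ 'n"
  where "lagrangian_frame A H \<gamma> \<Psi> t =
    (\<chi> i j. let v = trivialized_dflow A H \<gamma> \<Psi> (min t 1) (axis j 1, 0)
            in Complex (min 1 (2 - t) * fst v $ i) (snd v $ i))"

text \<open>
  With \<open>\<alpha>\<close> the continuous argument of the squared determinant along \<open>[0,2]\<close>, \<open>\<alpha> 2 / (2 * pi)\<close> is the
  Robbin--Salamon index of the path of Lagrangian subspaces relative to \<open>\<real>\<^sup>n \<times> 0\<close>. For \<open>H = \<pi>\<^sup>*f\<close> the
  path is \<open>graph (- t Hess f)\<close>: each positive (negative) eigenvalue of the Hessian contributes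
  \<open>- pi\<close> (\<open>pi\<close>) to \<open>\<alpha> 2\<close>. So adding \<open>n/2\<close> gives the Morse index of \<open>f\<close>.
\<close>

definition cz_index ::
    "('m, 'n::finite) base_chart set \<Rightarrow> (real \<Rightarrow> ('m, 'n) cotpoint \<Rightarrow> real) \<Rightarrow> (real \<Rightarrow> ('m, 'n) cotpoint) \<Rightarrow> int"
  where "cz_index A H \<gamma> = (THE k. \<exists>\<Psi> \<alpha>.
    vertical_trivialization A \<gamma> \<Psi> \<and> continuous_on {0..2} \<alpha> \<and> \<alpha> 0 = 0 \<and>
    (\<forall>t\<in>{0..2}. (det (lagrangian_frame A H \<gamma> \<Psi> t))\<^sup>2 =
       complex_of_real ((cmod (det (lagrangian_frame A H \<gamma> \<Psi> t)))\<^sup>2) * cis (\<alpha> t)) \<and>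
    real_of_int k = real CARD('n) / 2 + \<alpha> 2 / (2 * pi))"


section \<open>Almost complex structures\<close>

text \<open>\<open>christoffel g c x v w\<close> is the vector \<open>\<Gamma>(v, w)\<close> of the Levi-Civita connection (Koszul formula).\<close>

definition christoffel ::
    "(('m, 'e::euclidean_space) chart \<Rightarrow> 'e \<Rightarrow> 'e \<Rightarrow> 'e \<Rightarrow> real) \<Rightarrow> ('m, 'e) chart \<Rightarrow> 'e \<Rightarrow> 'e \<Rightarrow> 'e \<Rightarrow> 'e"
  where "christoffel g c x v w = (THE u. \<forall>z. 2 * g c x u z =
      frechet_derivative (\<lambda>y. g c y w z) (at x) v
    + frechet_derivative (\<lambda>y. g c y v z) (at x) w
    - frechet_derivative (\<lambda>y. g c y v w) (at x) z)"

text \<open>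
  The structure on \<open>T\<^sup>*N\<close> induced by \<open>g\<close>, at the point with coordinates \<open>(x, p)\<close>, as a relation
  between a vector and its image. The Levi-Civita connection splits tangent vectors into a horizontal
  part, the lift \<open>hor a\<close> of \<open>a \<in> T\<^sub>xN\<close> (along which \<open>p\<close> is parallel), and a vertical part \<open>ver b\<close>, the
  covector dual to \<open>b \<in> T\<^sub>xN\<close>. With \<open>\<omega> = dp \<and> dq\<close> and \<open>\<omega>(\<cdot>, J\<cdot>)\<close> positive, \<open>J\<close> maps
  \<open>hor a + ver b\<close> to \<open>hor b - ver a\<close>.
\<close>

definition induced_acs ::
    "(('m, 'n::finite) base_chart \<Rightarrow> real ^ 'n \<Rightarrow> real ^ 'n \<Rightarrow> real ^ 'n \<Rightarrow> real) \<Rightarrow>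
      ('m, 'n) base_chart \<Rightarrow> 'n phase \<Rightarrow> 'n phase \<Rightarrow> 'n phase \<Rightarrow> bool"
  where "induced_acs g c z V W \<longleftrightarrow>
    (let x = fst z; p = snd z;
         hor = (\<lambda>a. (a, \<chi> i. p \<bullet> christoffel g c x a (axis i 1)));
         ver = (\<lambda>b. (0, \<chi> i. g c x b (axis i 1)))
     in \<exists>a b. V = hor a + ver b \<and> W = hor b - ver a)"

text \<open>\<open>J t C z\<close> is the endomorphism at the point with coordinates \<open>z\<close> in the chart \<open>C\<close>.\<close>

type_synonym ('m, 'n) acs_path = "real \<Rightarrow> ('m, 'n) cot_chart \<Rightarrow> 'n phase \<Rightarrow> 'n phase \<Rightarrow> 'n phase"

definition acs_paths ::
    "('m, 'n::finite) base_chart set \<Rightarrow> (('m, 'n) base_chart \<Rightarrow> real ^ 'n \<Rightarrow> real ^ 'n \<Rightarrow> real ^ 'n \<Rightarrow> real) \<Rightarrow>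
      ('m, 'n) cotpoint set \<Rightarrow> ('m, 'n) acs_path set"
  where "acs_paths A g K = {J.
    (\<forall>C\<in>cot_atlas A.
       (\<forall>v. smooth_on ({0..1} \<times> cimg C) (\<lambda>(t, z). J t C z v)) \<and>
       (\<forall>t\<in>{0..1}. \<forall>x\<in>fst C. let j = J t C (snd C x) in
          linear j \<and> (\<forall>v. j (j v) = - v) \<and>
          (\<forall>v w. omega v (j w) = omega w (j v)) \<and>
          (\<forall>v. v \<noteq> 0 \<longrightarrow> omega v (j v) > 0) \<and>
          (\<forall>D\<in>cot_atlas A. x \<in> fst D \<longrightarrow>
             (\<forall>v. dtrans C D x (j v) = J t D (snd D x) (dtrans C D x v))))) \<and>
    (\<forall>c\<in>A. \<forall>C\<in>cot_atlas A. \<forall>t\<in>{0..1}. \<forall>x\<in>cotangent A - K.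
       C = ({x \<in> cotangent A. fst x \<in> fst c}, \<lambda>x. (snd c (fst x), snd x c)) \<longrightarrow> x \<in> fst C \<longrightarrow>
       (\<forall>v. induced_acs g c (snd C x) v (J t C (snd C x) v)))}"

text \<open>The topology of uniform convergence on compact sets of all derivatives in charts.\<close>

definition acs_topology ::
    "('m, 'n::finite) base_chart set \<Rightarrow> (('m, 'n) base_chart \<Rightarrow> real ^ 'n \<Rightarrow> real ^ 'n \<Rightarrow> real ^ 'n \<Rightarrow> real) \<Rightarrow>
      ('m, 'n) cotpoint set \<Rightarrow> ('m, 'n) acs_path topology"
  where "acs_topology A g K = topology_generated_by
    {{J' \<in> acs_paths A g K. \<forall>z\<in>{0..1} \<times> L.
        norm (iter_deriv ({0..1} \<times> cimg C) vs (\<lambda>(t, z). J' t C z w) z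
            - iter_deriv ({0..1} \<times> cimg C) vs (\<lambda>(t, z). J t C z w) z) < e}
     | J C L vs w e. J \<in> acs_paths A g K \<and> C \<in> cot_atlas A \<and> compact L \<and> L \<subseteq> cimg C \<and> e > 0}"

definition comeager_in :: "'x topology \<Rightarrow> 'x set \<Rightarrow> bool"
  where "comeager_in T S \<longleftrightarrow> (\<exists>\<U>. countable \<U> \<and>
    (\<forall>U\<in>\<U>. openin T U \<and> T closure_of U = topspace T) \<and> topspace T \<inter> \<Inter>\<U> \<subseteq> S)"

text \<open>
  A generic \<open>J\<close> satisfies \<open>P\<close>: for every sufficiently large compact set outside of which \<open>J\<close> is required
  to be the induced structure, \<open>P\<close> holds on a comeager set.
\<close>

definition generically ::
    "('m, 'n::finite) base_chart set \<Rightarrow> (('m, 'n) base_chart \<Rightarrow> real ^ 'n \<Rightarrow> real ^ 'n \<Rightarrow> real ^ 'n \<Rightarrow> real) \<Rightarrow>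
      (('m, 'n) acs_path \<Rightarrow> bool) \<Rightarrow> bool"
  where "generically A g P \<longleftrightarrow>
    (\<exists>K0. compactin (mtop (cot_atlas A)) K0 \<and>
      (\<forall>K. compactin (mtop (cot_atlas A)) K \<longrightarrow> K0 \<subseteq> K \<longrightarrow> comeager_in (acs_topology A g K) {J. P J}))"


section \<open>Floer homology\<close>

text \<open>The paths \<open>u(s, \<cdot>)\<close> converge uniformly to \<open>\<gamma>\<close> along the filter \<open>F\<close> of values of \<open>s\<close>.\<close>

definition converges_to_path ::
    "('m, 'n::finite) base_chart set \<Rightarrow> real filter \<Rightarrow> (real \<times> real \<Rightarrow> ('m, 'n) cotpoint) \<Rightarrow>
      (real \<Rightarrow> ('m, 'n) cotpoint) \<Rightarrow> bool"
  where "converges_to_path A F u \<gamma> \<longleftrightarrow>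
    (\<forall>V. openin (prod_topology (top_of_set {0..1}) (mtop (cot_atlas A))) V \<longrightarrow>
       (\<forall>t\<in>{0..1}. (t, \<gamma> t) \<in> V) \<longrightarrow> (\<forall>\<^sub>F s in F. \<forall>t\<in>{0..1}. (t, u (s, t)) \<in> V))"

definition floer_strips ::
    "('m, 'n::finite) base_chart set \<Rightarrow> (real \<Rightarrow> ('m, 'n) cotpoint \<Rightarrow> real) \<Rightarrow> ('m, 'n) acs_path \<Rightarrow>
      (real \<Rightarrow> ('m, 'n) cotpoint) \<Rightarrow> (real \<Rightarrow> ('m, 'n) cotpoint) \<Rightarrow> (real \<times> real \<Rightarrow> ('m, 'n) cotpoint) set"
  where "floer_strips A H J \<gamma>m \<gamma>p = {u \<in> extensional (UNIV \<times> {0..1}).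
    smooth_into (cot_atlas A) (UNIV \<times> {0..1}) u \<and>
    (\<forall>s. \<forall>t\<in>{0..1}. \<forall>C\<in>cot_atlas A. u (s, t) \<in> fst C \<longrightarrow>
       vector_derivative (\<lambda>s. snd C (u (s, t))) (at s) +
       J t C (snd C (u (s, t)))
         (vector_derivative (\<lambda>t. snd C (u (s, t))) (at t within {0..1})
           - ham_field (H t) C (snd C (u (s, t)))) = 0) \<and>
    (\<forall>s. u (s, 0) \<in> zero_section A \<and> u (s, 1) \<in> zero_section A) \<and>
    converges_to_path A at_bot u \<gamma>m \<and> converges_to_path A at_top u \<gamma>p}"

definition floer_count ::
    "('m, 'n::finite) base_chart set \<Rightarrow> (real \<Rightarrow> ('m, 'n) cotpoint \<Rightarrow> real) \<Rightarrow> ('m, 'n) acs_path \<Rightarrow>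
      (real \<Rightarrow> ('m, 'n) cotpoint) \<Rightarrow> (real \<Rightarrow> ('m, 'n) cotpoint) \<Rightarrow> nat"
  where "floer_count A H J \<gamma>m \<gamma>p =
    (let M = floer_strips A H J \<gamma>m \<gamma>p
     in card (M // {(u, v). u \<in> M \<and> v \<in> M \<and>
          (\<exists>r. \<forall>s. \<forall>t\<in>{0..1}. v (s, t) = u (s + r, t))}))"

text \<open>\<open>\<int>\<^sub>2\<close>-vector spaces with a given basis are rendered as finitely supported functions into \<open>bit\<close>.\<close>

definition floer_chains ::
    "('m, 'n::finite) base_chart set \<Rightarrow> (real \<Rightarrow> ('m, 'n) cotpoint \<Rightarrow> real) \<Rightarrow> int \<Rightarrow>
      ((real \<Rightarrow> ('m, 'n) cotpoint) \<Rightarrow>\<^sub>0 bit) set"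
  where "floer_chains A H k = {x. Poly_Mapping.keys x \<subseteq> {\<gamma> \<in> crit_paths A H. cz_index A H \<gamma> = k}}"

definition floer_diff ::
    "('m, 'n::finite) base_chart set \<Rightarrow> (real \<Rightarrow> ('m, 'n) cotpoint \<Rightarrow> real) \<Rightarrow> ('m, 'n) acs_path \<Rightarrow>
      ((real \<Rightarrow> ('m, 'n) cotpoint) \<Rightarrow>\<^sub>0 bit) \<Rightarrow> ((real \<Rightarrow> ('m, 'n) cotpoint) \<Rightarrow>\<^sub>0 bit)"
  where "floer_diff A H J x =
    (\<Sum>\<gamma>\<in>Poly_Mapping.keys x. \<Sum>\<gamma>'\<in>{\<gamma>' \<in> crit_paths A H. cz_index A H \<gamma> - cz_index A H \<gamma>' = 1}.
       Poly_Mapping.single \<gamma>' (of_nat (floer_count A H J \<gamma> \<gamma>')))"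

definition floer_cycles ::
    "('m, 'n::finite) base_chart set \<Rightarrow> (real \<Rightarrow> ('m, 'n) cotpoint \<Rightarrow> real) \<Rightarrow> ('m, 'n) acs_path \<Rightarrow> int \<Rightarrow>
      ((real \<Rightarrow> ('m, 'n) cotpoint) \<Rightarrow>\<^sub>0 bit) set"
  where "floer_cycles A H J k = {x \<in> floer_chains A H k. floer_diff A H J x = 0}"

definition floer_homology ::
    "('m, 'n::finite) base_chart set \<Rightarrow> (real \<Rightarrow> ('m, 'n) cotpoint \<Rightarrow> real) \<Rightarrow> ('m, 'n) acs_path \<Rightarrow> int \<Rightarrow>
      ((real \<Rightarrow> ('m, 'n) cotpoint) \<Rightarrow>\<^sub>0 bit) set set"
  where "floer_homology A H J k =
    (\<lambda>z. z +o floer_diff A H J ` floer_chains A H (k + 1)) ` floer_cycles A H J k"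

definition chains2 :: "nat \<Rightarrow> 'a topology \<Rightarrow> (((nat \<Rightarrow> real) \<Rightarrow> 'a) \<Rightarrow>\<^sub>0 bit) set"
  where "chains2 k T = {x. Poly_Mapping.keys x \<subseteq> singular_simplex_set k T}"

definition boundary2 :: "nat \<Rightarrow> (((nat \<Rightarrow> real) \<Rightarrow> 'a) \<Rightarrow>\<^sub>0 bit) \<Rightarrow> (((nat \<Rightarrow> real) \<Rightarrow> 'a) \<Rightarrow>\<^sub>0 bit)"
  where "boundary2 k x = (if k = 0 then 0 else
    (\<Sum>\<sigma>\<in>Poly_Mapping.keys x. \<Sum>i\<le>k. Poly_Mapping.single (singular_face k i \<sigma>) 1))"

definition homology2 :: "nat \<Rightarrow> 'a topology \<Rightarrow> (((nat \<Rightarrow> real) \<Rightarrow> 'a) \<Rightarrow>\<^sub>0 bit) set set"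
  where "homology2 k T =
    (\<lambda>z. z +o boundary2 (Suc k) ` chains2 (Suc k) T) ` {x \<in> chains2 k T. boundary2 k x = 0}"

text \<open>The generator of \<open>H\<^sub>n(N; \<int>\<^sub>2) \<cong> \<int>\<^sub>2\<close>.\<close>

definition fundamental_class ::
    "('m, 'n::finite) base_chart set \<Rightarrow> (((nat \<Rightarrow> real) \<Rightarrow> 'm) \<Rightarrow>\<^sub>0 bit) set"
  where "fundamental_class A = (THE a. a \<in> homology2 CARD('n) (mtop A) \<and>
    a \<noteq> boundary2 (Suc CARD('n)) ` chains2 (Suc CARD('n)) (mtop A))"


section \<open>Spectral invariants\<close>

text \<open>The level of a class \<open>a\<close> of Floer homology in degree \<open>k\<close>.\<close>

definition floer_level ::
    "('m, 'n::finite) base_chart set \<Rightarrow> (real \<Rightarrow> ('m, 'n) cotpoint \<Rightarrow> real) \<Rightarrow> ('m, 'n) acs_path \<Rightarrow> int \<Rightarrow>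
      ((real \<Rightarrow> ('m, 'n) cotpoint) \<Rightarrow>\<^sub>0 bit) set \<Rightarrow> real"
  where "floer_level A H J k a = Inf {r. \<exists>z\<in>floer_cycles A H J k. z \<in> a \<and>
    (\<forall>\<gamma>\<in>Poly_Mapping.keys z. action A H \<gamma> < r)}"

text \<open>
  Addition of homology classes is the Minkowski sum of cosets. Both \<open>H\<^sub>n(N; \<int>\<^sub>2)\<close> and Floer homology in
  degree \<open>n\<close> have exactly one nonzero element, so any isomorphism between them is the canonical
  one.
\<close>

definition ell_plus_transversal ::
    "('m, 'n::finite) base_chart set \<Rightarrow> (('m, 'n) base_chart \<Rightarrow> real ^ 'n \<Rightarrow> real ^ 'n \<Rightarrow> real ^ 'n \<Rightarrow> real) \<Rightarrow>
      (real \<Rightarrow> ('m, 'n) cotpoint \<Rightarrow> real) \<Rightarrow> real"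
  where "ell_plus_transversal A g H = (THE r. generically A g (\<lambda>J.
    \<exists>\<Phi>. bij_betw \<Phi> (homology2 CARD('n) (mtop A)) (floer_homology A H J (int CARD('n))) \<and>
      (\<forall>a\<in>homology2 CARD('n) (mtop A). \<forall>b\<in>homology2 CARD('n) (mtop A). \<Phi> (a + b) = \<Phi> a + \<Phi> b) \<and>
      floer_level A H J (int CARD('n)) (\<Phi> (fundamental_class A)) = r))"

definition ell_plus_ham ::
    "('m, 'n::finite) base_chart set \<Rightarrow> (('m, 'n) base_chart \<Rightarrow> real ^ 'n \<Rightarrow> real ^ 'n \<Rightarrow> real ^ 'n \<Rightarrow> real) \<Rightarrow>
      (real \<Rightarrow> ('m, 'n) cotpoint \<Rightarrow> real) \<Rightarrow> real"
  where "ell_plus_ham A g H = (THE r. \<forall>e>0. \<exists>d>0. \<forall>H'.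
    compact_hamiltonian A H' \<and> transversal_end A H' \<and>
    (\<forall>t\<in>{0..1}. \<forall>x\<in>cotangent A. \<bar>H' t x - H t x\<bar> < d) \<longrightarrow> \<bar>ell_plus_transversal A g H' - r\<bar> < e)"

definition ell_plus ::
    "('m, 'n::finite) base_chart set \<Rightarrow> (('m, 'n) base_chart \<Rightarrow> real ^ 'n \<Rightarrow> real ^ 'n \<Rightarrow> real ^ 'n \<Rightarrow> real) \<Rightarrow>
      (('m, 'n) cotpoint \<Rightarrow> ('m, 'n) cotpoint) \<Rightarrow> real"
  where "ell_plus A g \<phi> = (THE r. \<exists>H. compact_hamiltonian A H \<and>
    (\<forall>x\<in>cotangent A. ham_flow A H 1 x = \<phi> x) \<and> ell_plus_ham A g H = r)"

definition mu0 ::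
    "('m, 'n::finite) base_chart set \<Rightarrow> (('m, 'n) base_chart \<Rightarrow> real ^ 'n \<Rightarrow> real ^ 'n \<Rightarrow> real ^ 'n \<Rightarrow> real) \<Rightarrow>
      (('m, 'n) cotpoint \<Rightarrow> ('m, 'n) cotpoint) \<Rightarrow> real"
  where "mu0 A g \<phi> = lim (\<lambda>k. ell_plus A g (\<phi> ^^ k) / real k)"

definition zeta ::
    "('m, 'n::finite) base_chart set \<Rightarrow> (('m, 'n) base_chart \<Rightarrow> real ^ 'n \<Rightarrow> real ^ 'n \<Rightarrow> real ^ 'n \<Rightarrow> real) \<Rightarrow>
      (('m, 'n) cotpoint \<Rightarrow> real) \<Rightarrow> real"
  where "zeta A g f = mu0 A g (ham_flow A (\<lambda>t. f) 1)"

definition superheavy ::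
    "('m, 'n::finite) base_chart set \<Rightarrow> (('m, 'n) base_chart \<Rightarrow> real ^ 'n \<Rightarrow> real ^ 'n \<Rightarrow> real ^ 'n \<Rightarrow> real) \<Rightarrow>
      ('m, 'n) cotpoint set \<Rightarrow> bool"
  where "superheavy A g X \<longleftrightarrow>
    compactin (mtop (cot_atlas A)) X \<and>
    (\<forall>f c. compact_function A f \<longrightarrow> (\<forall>x\<in>X. f x = c) \<longrightarrow> zeta A g f = c)"

end

theory Submission
  imports Defs
begin

text \<open>
  If \<open>X\<close> and \<open>X'\<close> were disjoint, there would be a smooth compactly supported function \<open>f\<close> on the cotangent bundle with
  \<open>f = 0\<close> on \<open>X\<close> and \<open>f = 1\<close> on \<open>X'\<close>. Superheaviness of the two sets then gives \<open>\<zeta>(f) = 0\<close> and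
  \<open>\<zeta>(f) = 1\<close>, which is absurd because \<open>\<zeta>(f)\<close> is a single number. The work consists in producing \<open>f\<close>.

  A function separating a compact set from the complement of an open neighbourhood exists on every Hausdorff
  smooth manifold (\<open>smooth_separation\<close>): transport Euclidean bump functions by charts and combine finitely many of
  them. To apply this to the cotangent bundle, its atlas has to be smooth (\<open>smooth_atlas_cot_atlas\<close>) and its topology Hausdorff
  (\<open>Hausdorff_space_cot_atlas\<close>). Both reduce to the base manifold, because a covector is determined by its coordinates in
  one chart, which are arbitrary, and transforms by the transposed derivative of the transition map.

  All smoothness claims rest on a calculus of \<open>k\<close> times differentiable functions, in which closure under products and
  composition is proved by induction on \<open>k\<close>.
\<close>


section \<open>Calculus of smooth functions on open sets\<close>

text \<open>
  On an open set, smoothness is \<open>k_diff k\<close> for every \<open>k\<close>. Counting derivatives, rather than asking for all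
  of them at once, is what allows calculus rules to be proved by induction: the derivative of a product
  or of a composition is built from functions with one derivative less. The count starts from no condition
  at all (not from continuity), and derivatives are those of the whole space rather than within \<open>S\<close>, so that
  the condition may be checked point by point and on the members of a cover.
\<close>

primrec k_diff :: "nat \<Rightarrow> 'v::real_normed_vector set \<Rightarrow> ('v \<Rightarrow> 'w::real_normed_vector) \<Rightarrow> bool"
  where
    "k_diff 0 S f \<longleftrightarrow> True"
  | "k_diff (Suc k) S f \<longleftrightarrow> (\<forall>z\<in>S. f differentiable at z) \<and>
       (\<forall>v. k_diff k S (\<lambda>z. frechet_derivative f (at z) v))"

lemma has_derivative_cong_open:
  assumes "open S" "z \<in> S" "\<And>y. y \<in> S \<Longrightarrow> f y = g y"
  shows "(f has_derivative f') (at z) \<longleftrightarrow> (g has_derivative f') (at z)"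
  using assms has_derivative_transform_within_open[of f f' z UNIV S g]
    has_derivative_transform_within_open[of g f' z UNIV S f] by metis

lemma frechet_derivative_cong_open:
  assumes "open S" "z \<in> S" "\<And>y. y \<in> S \<Longrightarrow> f y = g y"
  shows "frechet_derivative f (at z) = frechet_derivative g (at z)"
  using has_derivative_cong_open[OF assms] unfolding frechet_derivative_def by simp

lemma k_diff_cong:
  assumes "open S" "\<And>y. y \<in> S \<Longrightarrow> f y = g y"
  shows "k_diff k S f \<longleftrightarrow> k_diff k S g"
  using assms(2)
proof (induction k arbitrary: f g)
  case (Suc k)
  have "f differentiable at z \<longleftrightarrow> g differentiable at z" if "z \<in> S" for z
    unfolding differentiable_def using has_derivative_cong_open[OF assms(1) that Suc.prems] by simp
  moreover have "k_diff k S (\<lambda>z. frechet_derivative f (at z) v) \<longleftrightarrow>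
      k_diff k S (\<lambda>z. frechet_derivative g (at z) v)" for v
    by (rule Suc.IH) (use frechet_derivative_cong_open[OF assms(1) _ Suc.prems] in simp)
  ultimately show ?case by simp
qed simp

lemma k_diff_mono: "k_diff (Suc k) S f \<Longrightarrow> k_diff k S f"
  by (induction k arbitrary: f) auto

lemma k_diff_pointwise: "k_diff k S f \<longleftrightarrow> (\<forall>z\<in>S. k_diff k {z} f)"
  by (induction k arbitrary: f) auto

lemma k_diff_subset: "k_diff k T f \<Longrightarrow> S \<subseteq> T \<Longrightarrow> k_diff k S f"
  using k_diff_pointwise by blast

lemma k_diff_Un: "k_diff k S f \<Longrightarrow> k_diff k T f \<Longrightarrow> k_diff k (S \<union> T) f"
  using k_diff_pointwise by blast

text \<open>
  The lists of directions of length less than \<open>k\<close> are the empty one, which asks for the first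
  derivative, and those with a head \<open>v\<close>, which differentiate the directional derivative along \<open>v\<close>;
  this matches the recursion of \<open>k_diff\<close>.
\<close>

lemma iter_deriv_iff_k_diff:
  assumes "open S"
  shows "(\<forall>vs. length vs < k \<longrightarrow> iter_deriv S vs f differentiable_on S) \<longleftrightarrow> k_diff k S f"
proof (induction k arbitrary: f)
  case (Suc k)
  have "(\<forall>vs. length vs < Suc k \<longrightarrow> iter_deriv S vs f differentiable_on S) \<longleftrightarrow>
      f differentiable_on S \<and> (\<forall>v vs. length vs < k \<longrightarrow>
        iter_deriv S vs (\<lambda>z. frechet_derivative f (at z within S) v) differentiable_on S)"
    (is "?L \<longleftrightarrow> ?R")
  proof
    assume L: ?L
    have "iter_deriv S [] f differentiable_on S" using L by (metis length_0_conv zero_less_Suc)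
    moreover have "iter_deriv S (v # vs) f differentiable_on S" if "length vs < k" for v vs
      using L that by (metis Suc_less_eq length_Cons)
    ultimately show ?R by simp
  next
    assume ?R
    then show ?L by (metis Suc_less_eq iter_deriv.simps length_Cons list.exhaust)
  qed
  also have "\<dots> \<longleftrightarrow> (\<forall>z\<in>S. f differentiable at z) \<and>
      (\<forall>v. k_diff k S (\<lambda>z. frechet_derivative f (at z within S) v))"
    using Suc.IH differentiable_on_eq_differentiable_at[OF assms] by blast
  also have "\<dots> \<longleftrightarrow> k_diff (Suc k) S f"
  proof -
    \<comment> \<open>Off \<open>S\<close> the two kinds of derivative may differ, but only their values on \<open>S\<close> matter.\<close>
    have "k_diff k S (\<lambda>z. frechet_derivative f (at z within S) v) \<longleftrightarrow>
        k_diff k S (\<lambda>z. frechet_derivative f (at z) v)" for v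
      by (rule k_diff_cong[OF assms]) (simp add: at_within_open[OF _ assms])
    then show ?thesis by simp
  qed
  finally show ?case .
qed simp

lemma smooth_on_iff_k_diff:
  assumes "open S"
  shows "smooth_on S f \<longleftrightarrow> (\<forall>k. k_diff k S f)"
proof
  assume "smooth_on S f"
  then obtain U F where U: "open U" "S \<subseteq> U" "\<forall>x\<in>S. F x = f x"
    and F: "\<forall>vs. iter_deriv U vs F differentiable_on U"
    unfolding smooth_on_def by blast
  have "k_diff k U F" for k
    using iter_deriv_iff_k_diff[OF U(1)] F by blast
  then show "\<forall>k. k_diff k S f"
    using k_diff_subset[OF _ U(2)] k_diff_cong[OF assms] U(3) by blast
next
  assume "\<forall>k. k_diff k S f"
  then have "iter_deriv S vs f differentiable_on S" for vs
    using iter_deriv_iff_k_diff[OF assms, of "Suc (length vs)" f] by blast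
  then show "smooth_on S f"
    unfolding smooth_on_def using assms by blast
qed

lemma smooth_on_imp_continuous_on:
  assumes "open S" "smooth_on S f"
  shows "continuous_on S f"
proof -
  have "k_diff (Suc 0) S f"
    using assms smooth_on_iff_k_diff by blast
  then have "\<forall>z\<in>S. f differentiable at z" by simp
  then show ?thesis
    using continuous_at_imp_continuous_on differentiable_imp_continuous_within by blast
qed

lemma k_diff_SucI:
  assumes "open S" "\<And>z. z \<in> S \<Longrightarrow> (f has_derivative f' z) (at z)"
    and "\<And>v. k_diff k S (\<lambda>z. f' z v)"
  shows "k_diff (Suc k) S f"
proof -
  have eq: "f' z = frechet_derivative f (at z)" if "z \<in> S" for z
    using assms(2)[OF that] by (rule frechet_derivative_at)
  have "k_diff k S (\<lambda>z. f' z v) \<longleftrightarrow> k_diff k S (\<lambda>z. frechet_derivative f (at z) v)" for v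
    by (rule k_diff_cong[OF assms(1)]) (simp add: eq)
  then show ?thesis
    using assms(2,3) by (auto simp: differentiable_def)
qed

lemma k_diff_Suc_has_derivative:
  "k_diff (Suc k) S f \<Longrightarrow> z \<in> S \<Longrightarrow> (f has_derivative frechet_derivative f (at z)) (at z)"
  by (simp add: frechet_derivative_works)

lemma k_diff_const: "open S \<Longrightarrow> k_diff k S (\<lambda>_. c)"
  by (induction k arbitrary: c) (auto intro!: k_diff_SucI derivative_eq_intros simp del: k_diff.simps(2))

lemma k_diff_bounded_linear:
  assumes "open S" "bounded_linear f"
  shows "k_diff k S f"
  by (cases k) (auto intro!: k_diff_SucI[where f' = "\<lambda>_. f"] k_diff_const assms bounded_linear_imp_has_derivative
     simp del: k_diff.simps(2))

lemma k_diff_add: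
  assumes "open S"
  shows "k_diff k S f \<Longrightarrow> k_diff k S g \<Longrightarrow> k_diff k S (\<lambda>z. f z + g z)"
proof (induction k arbitrary: f g)
  case (Suc k)
  show ?case
    by (rule k_diff_SucI[OF assms has_derivative_add[OF k_diff_Suc_has_derivative[OF Suc.prems(1)]
          k_diff_Suc_has_derivative[OF Suc.prems(2)]]]) (use Suc in auto)
qed simp

lemma k_diff_sum:
  assumes "open S" "finite I" "\<And>i. i \<in> I \<Longrightarrow> k_diff k S (f i)"
  shows "k_diff k S (\<lambda>z. \<Sum>i\<in>I. f i z)"
  using assms(2,3) by (induction I) (auto intro: k_diff_const k_diff_add assms(1))

lemma k_diff_Pair:
  assumes "open S"
  shows "k_diff k S f \<Longrightarrow> k_diff k S g \<Longrightarrow> k_diff k S (\<lambda>z. (f z, g z))"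
proof (induction k arbitrary: f g)
  case (Suc k)
  show ?case
    by (rule k_diff_SucI[OF assms has_derivative_Pair[OF k_diff_Suc_has_derivative[OF Suc.prems(1)]
          k_diff_Suc_has_derivative[OF Suc.prems(2)]]]) (use Suc in auto)
qed simp

lemma k_diff_bilinear:
  assumes "open S" "bounded_bilinear b"
  shows "k_diff k S f \<Longrightarrow> k_diff k S g \<Longrightarrow> k_diff k S (\<lambda>z. b (f z) (g z))"
proof (induction k arbitrary: f g)
  case (Suc k)
  note fg = k_diff_mono[OF Suc.prems(1)] k_diff_mono[OF Suc.prems(2)]
  show ?case
    by (rule k_diff_SucI[OF assms(1) bounded_bilinear.FDERIV[OF assms(2)
            k_diff_Suc_has_derivative[OF Suc.prems(1)] k_diff_Suc_has_derivative[OF Suc.prems(2)]]])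
      (use Suc fg in \<open>auto intro!: k_diff_add assms(1)\<close>)
qed simp

lemmas k_diff_mult = k_diff_bilinear[OF _ bounded_bilinear_mult]
lemmas k_diff_scaleR = k_diff_bilinear[OF _ bounded_bilinear_scaleR]
lemmas k_diff_inner = k_diff_bilinear[OF _ bounded_bilinear_inner]

lemma k_diff_diff:
  fixes f g :: "_ \<Rightarrow> 'w::real_normed_vector"
  assumes "open S" "k_diff k S f" "k_diff k S g"
  shows "k_diff k S (\<lambda>z. f z - g z)"
  using k_diff_add[OF assms(1,2) k_diff_scaleR[OF assms(1) k_diff_const[OF assms(1), of _ "-1"] assms(3)]]
  by simp

text \<open>
  Chain rule: \<open>D(g \<circ> f)(z) v = Dg (f z) (Df z v)\<close>. The direction in which \<open>g\<close> is differentiated varies with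
  \<open>z\<close>, so the induction hypothesis does not apply to this expression. Expanding \<open>Df z v\<close> in an orthonormal
  basis replaces it by products of \<open>Df z v \<bullet> b\<close> with derivatives of \<open>g\<close> in fixed directions.
\<close>

lemma k_diff_compose:
  fixes f :: "'v::real_normed_vector \<Rightarrow> 'w::euclidean_space" and g :: "'w \<Rightarrow> 'x::real_normed_vector"
  assumes "open S" "f ` S \<subseteq> T"
  shows "k_diff k S f \<Longrightarrow> k_diff k T g \<Longrightarrow> k_diff k S (\<lambda>z. g (f z))"
proof (induction k arbitrary: g)
  case (Suc k)
  let ?f' = "\<lambda>z. frechet_derivative f (at z)" and ?g' = "\<lambda>z. frechet_derivative g (at z)"
  have fz: "f z \<in> T" if "z \<in> S" for z using assms(2) that by blast
  have der: "((\<lambda>z. g (f z)) has_derivative (\<lambda>v. ?g' (f z) (?f' z v))) (at z)" if "z \<in> S" for z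
    using has_derivative_compose[OF k_diff_Suc_has_derivative[OF Suc.prems(1) that]
        k_diff_Suc_has_derivative[OF Suc.prems(2) fz[OF that]]] .
  have "k_diff k S (\<lambda>z. ?g' (f z) b)" for b
    by (rule Suc.IH[OF k_diff_mono[OF Suc.prems(1)]]) (use Suc.prems(2) in simp)
  then have sum: "k_diff k S (\<lambda>z. \<Sum>b\<in>Basis. (?f' z v \<bullet> b) *\<^sub>R ?g' (f z) b)" for v
    using Suc.prems(1) by (intro k_diff_sum k_diff_scaleR k_diff_inner k_diff_const assms(1)) auto
  have coords: "(\<Sum>b\<in>Basis. (?f' z v \<bullet> b) *\<^sub>R ?g' (f z) b) = ?g' (f z) (?f' z v)"
    if "z \<in> S" for z v
  proof -
    interpret linear "?g' (f z)"
      using has_derivative_linear[OF k_diff_Suc_has_derivative[OF Suc.prems(2) fz[OF that]]] .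
    show ?thesis
      by (subst euclidean_representation[symmetric, of "?f' z v"]) (simp add: sum scale del: euclidean_representation)
  qed
  have "k_diff k S (\<lambda>z. \<Sum>b\<in>Basis. (?f' z v \<bullet> b) *\<^sub>R ?g' (f z) b) \<longleftrightarrow>
      k_diff k S (\<lambda>z. ?g' (f z) (?f' z v))" for v
    by (rule k_diff_cong[OF assms(1)]) (rule coords)
  then have "k_diff k S (\<lambda>z. ?g' (f z) (?f' z v))" for v
    using sum by blast
  then show ?case
    by (intro k_diff_SucI[OF assms(1) der])
qed simp

lemma k_diff_prod:
  fixes f :: "'i \<Rightarrow> 'v::real_normed_vector \<Rightarrow> real"
  assumes "open S" "finite I" "\<And>i. i \<in> I \<Longrightarrow> k_diff k S (f i)"
  shows "k_diff k S (\<lambda>z. \<Prod>i\<in>I. f i z)"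
  using assms(2,3) by (induction I) (auto intro: k_diff_const k_diff_mult assms(1))

lemma k_diff_inverse: "k_diff k (- {0}) (inverse :: real \<Rightarrow> real)"
proof (induction k)
  case (Suc k)
  have o: "open (- {0::real})" by (simp add: open_Compl)
  show ?case
  proof (rule k_diff_SucI[OF o, where f' = "\<lambda>z v. - (inverse z * v * inverse z)"])
    show "k_diff k (- {0}) (\<lambda>z. - (inverse z * v * inverse z))" for v :: real
      using k_diff_diff[OF o k_diff_const[OF o, of _ 0] k_diff_mult[OF o k_diff_mult[OF o Suc k_diff_const[OF o, of _ v]] Suc]]
      by simp
  qed (auto intro!: derivative_eq_intros)
qed simp


section \<open>Bump functions\<close>

text \<open>
  \<open>flat 0\<close> is the classical smooth function that is positive exactly on the positive half-line and flat at \<open>0\<close>.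
  The extra powers of \<open>1/t\<close> make the family closed under differentiation, up to linear combinations.
\<close>

definition flat :: "nat \<Rightarrow> real \<Rightarrow> real"
  where "flat m t = (if t > 0 then exp (- inverse t) * inverse t ^ m else 0)"

lemma flat_has_derivative:
  "(flat m has_real_derivative (flat (m + 2) t - real m * flat (m + 1) t)) (at t)"
proof -
  consider "t > 0" | "t < 0" | "t = 0" by linarith
  then show ?thesis
  proof cases
    case 1
    let ?i = "inverse t"
    have "((\<lambda>t. exp (- inverse t) * inverse t ^ m) has_real_derivative
        exp (- ?i) * ?i ^ 2 * ?i ^ m + real m * ?i ^ (m - 1) * (- (?i ^ 2)) * exp (- ?i)) (at t)"
      using 1 by (auto intro!: derivative_eq_intros simp: power2_eq_square)
    also have "exp (- ?i) * ?i ^ 2 * ?i ^ m + real m * ?i ^ (m - 1) * (- (?i ^ 2)) * exp (- ?i) =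
        flat (m + 2) t - real m * flat (m + 1) t"
      using 1 by (cases m) (simp_all add: flat_def algebra_simps power2_eq_square del: power_inverse inverse_eq_divide)
    finally have "((\<lambda>t. exp (- inverse t) * inverse t ^ m) has_real_derivative
        (flat (m + 2) t - real m * flat (m + 1) t)) (at t)" .
    then show ?thesis
      by (rule has_field_derivative_transform_within_open[where S = "{0<..}"]) (use 1 in \<open>auto simp: flat_def\<close>)
  next
    case 2
    have "((\<lambda>t. 0) has_real_derivative (flat (m + 2) t - real m * flat (m + 1) t)) (at t)"
      using 2 by (simp add: flat_def)
    then show ?thesis
      by (rule has_field_derivative_transform_within_open[where S = "{..<0}"]) (use 2 in \<open>auto simp: flat_def\<close>)
  next
    case 3
    \<comment> \<open>With \<open>s = 1/h\<close> the difference quotient at \<open>0\<close> is a power of \<open>s\<close> divided by \<open>exp s\<close>.\<close>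
    have "((\<lambda>s::real. s ^ (m + 1) / exp s) \<longlongrightarrow> 0) at_top"
      by (rule tendsto_power_div_exp_0)
    then have "((\<lambda>h::real. inverse h ^ (m + 1) / exp (inverse h)) \<longlongrightarrow> 0) (at_right 0)"
      by (rule filterlim_compose) (rule filterlim_inverse_at_top_right)
    then have "((\<lambda>h. flat m h / h) \<longlongrightarrow> 0) (at_right 0)"
      by (rule Lim_transform_eventually)
        (auto simp: eventually_at_filter flat_def exp_minus field_simps)
    moreover have "((\<lambda>h. flat m h / h) \<longlongrightarrow> 0) (at_left 0)"
      by (rule Lim_transform_eventually[OF tendsto_const])
        (auto simp: eventually_at_filter flat_def)
    ultimately have "((\<lambda>h. flat m h / h) \<longlongrightarrow> 0) (at 0)"
      by (simp add: filterlim_split_at)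
    then show ?thesis
      using 3 by (simp add: DERIV_def flat_def)
  qed
qed

lemma k_diff_flat: "k_diff k UNIV (flat m)"
proof (induction k arbitrary: m)
  case (Suc k)
  show ?case
  proof (rule k_diff_SucI[OF open_UNIV, where f' = "\<lambda>t v. (flat (m + 2) t - real m * flat (m + 1) t) * v"])
    show "(flat m has_derivative (\<lambda>v. (flat (m + 2) t - real m * flat (m + 1) t) * v)) (at t)" for t
      using flat_has_derivative[of m t] by (simp add: has_field_derivative_def)
    show "k_diff k UNIV (\<lambda>t. (flat (m + 2) t - real m * flat (m + 1) t) * v)" for v
      by (intro k_diff_mult k_diff_diff k_diff_const Suc open_UNIV)
  qed
qed simp

definition smooth_step :: "real \<Rightarrow> real"
  where "smooth_step t = flat 0 t * inverse (flat 0 t + flat 0 (1 - t))"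

lemma smooth_step_eq_0: "t \<le> 0 \<Longrightarrow> smooth_step t = 0"
  and smooth_step_eq_1: "1 \<le> t \<Longrightarrow> smooth_step t = 1"
  by (auto simp: smooth_step_def flat_def)

text \<open>
  The denominator never vanishes, since \<open>t\<close> and \<open>1 - t\<close> are not both nonpositive.
\<close>

lemma k_diff_smooth_step: "k_diff k UNIV smooth_step"
proof -
  have "flat 0 t + flat 0 (1 - t) \<noteq> 0" for t
    by (auto simp: flat_def add_pos_pos less_imp_neq[symmetric])
  then have "(\<lambda>t. flat 0 t + flat 0 (1 - t)) ` UNIV \<subseteq> - {0}"
    by auto
  then show ?thesis
    unfolding smooth_step_def
    by (intro k_diff_mult k_diff_flat open_UNIV k_diff_add
        k_diff_compose[OF open_UNIV _ _ k_diff_inverse] k_diff_compose[OF open_UNIV subset_UNIV _ k_diff_flat]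
        k_diff_diff k_diff_const k_diff_bounded_linear bounded_linear_ident) 
qed

text \<open>
  With \<open>s = 2 / r\<^sup>2\<close> this function of \<open>z\<close> is \<open>1\<close> near \<open>a\<close> and vanishes at distance at least \<open>r\<close> from \<open>a\<close>. Using the
  squared distance keeps it smooth at \<open>a\<close>.
\<close>

lemma k_diff_bump:
  fixes a :: "'v::euclidean_space"
  shows "k_diff k UNIV (\<lambda>z. smooth_step (2 - ((z - a) \<bullet> (z - a)) * s))"
  by (intro k_diff_compose[OF open_UNIV subset_UNIV _ k_diff_smooth_step] k_diff_diff k_diff_const
     k_diff_mult k_diff_inner k_diff_bounded_linear bounded_linear_ident open_UNIV)



section \<open>Smooth separation on Hausdorff manifolds\<close>

context
  fixes A :: "('m, 'e::euclidean_space) chart set"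
  assumes A: "smooth_atlas A"
begin

lemma chart_inj_on: "c \<in> A \<Longrightarrow> inj_on (snd c) (fst c)"
  and chart_image_open: "c \<in> A \<Longrightarrow> open (cimg c)"
  and overlap_open: "c \<in> A \<Longrightarrow> d \<in> A \<Longrightarrow> open (snd c ` (fst c \<inter> fst d))"
  and transition_smooth: "c \<in> A \<Longrightarrow> d \<in> A \<Longrightarrow> smooth_on (snd c ` (fst c \<inter> fst d)) (snd d \<circ> cinv c)"
  using A unfolding smooth_atlas_def by auto

lemma cinv_chart [simp]: "c \<in> A \<Longrightarrow> x \<in> fst c \<Longrightarrow> cinv c (snd c x) = x"
  using chart_inj_on by (simp add: inv_into_f_f)

lemma openin_mtop:
  "openin (mtop A) U \<longleftrightarrow> U \<subseteq> carrier_of A \<and> (\<forall>c\<in>A. open (snd c ` (U \<inter> fst c)))"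
proof -
  have Int: "snd c ` ((S \<inter> T) \<inter> fst c) = snd c ` (S \<inter> fst c) \<inter> snd c ` (T \<inter> fst c)" if "c \<in> A" for c S T
    using inj_on_image_Int[OF chart_inj_on[OF that], of "S \<inter> fst c" "T \<inter> fst c"]
    by (simp add: Int_ac)
  have Un: "snd c ` (\<Union>\<K> \<inter> fst c) = (\<Union>K\<in>\<K>. snd c ` (K \<inter> fst c))" for c \<K>
    by blast
  have "istopology (\<lambda>U. U \<subseteq> carrier_of A \<and> (\<forall>c\<in>A. open (snd c ` (U \<inter> fst c))))"
    unfolding istopology_def
  proof (rule conjI; safe)
    fix S T c assume "c \<in> A" "\<forall>c\<in>A. open (snd c ` (S \<inter> fst c))" "\<forall>c\<in>A. open (snd c ` (T \<inter> fst c))"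
    then show "open (snd c ` ((S \<inter> T) \<inter> fst c))"
      by (simp only: Int open_Int)
  next
    fix \<K> c assume "c \<in> A"
      "\<forall>K\<in>\<K>. K \<subseteq> carrier_of A \<and> (\<forall>c\<in>A. open (snd c ` (K \<inter> fst c)))"
    then show "open (snd c ` (\<Union>\<K> \<inter> fst c))"
      unfolding Un by (intro open_UN) blast
  qed blast+
  then show ?thesis
    unfolding mtop_def by (simp add: topology_inverse')
qed

lemma topspace_mtop: "topspace (mtop A) = carrier_of A"
proof -
  have "carrier_of A \<inter> fst c = fst c" if "c \<in> A" for c
    using that unfolding carrier_of_def by blast
  then have "openin (mtop A) (carrier_of A)"
    using openin_mtop chart_image_open by simp
  then show ?thesis
    using openin_mtop openin_subset openin_topspace by blast
qed

text \<open>
  Charts are homeomorphisms onto their images. Openness in \<open>mtop\<close> is tested in every chart \<open>d\<close>, where the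
  set in question is the preimage of \<open>V\<close> under a transition map, which is continuous.
\<close>

lemma open_cinv_image:
  assumes c: "c \<in> A" and V: "open V" "V \<subseteq> cimg c"
  shows "openin (mtop A) (cinv c ` V)"
  unfolding openin_mtop
proof (intro conjI ballI)
  have fc: "cinv c ` V \<subseteq> fst c"
    using V(2) inv_into_into[of _ "snd c" "fst c"] by blast
  then show "cinv c ` V \<subseteq> carrier_of A"
    using c unfolding carrier_of_def by blast
  fix d assume d: "d \<in> A"
  have "snd d ` (cinv c ` V \<inter> fst d) =
      snd d ` (fst d \<inter> fst c) \<inter> (snd c \<circ> cinv d) -` V" (is "?L = ?R")
  proof
    show "?L \<subseteq> ?R"
    proof
      fix y assume "y \<in> ?L"
      then obtain v where v: "v \<in> V" "cinv c v \<in> fst d" "y = snd d (cinv c v)" by blast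
      moreover have "snd c (cinv c v) = v" using v(1) V(2) by (meson f_inv_into_f subsetD)
      ultimately show "y \<in> ?R" using fc d by auto
    qed
    show "?R \<subseteq> ?L"
    proof
      fix y assume "y \<in> ?R"
      then obtain x where x: "x \<in> fst d" "x \<in> fst c" "y = snd d x" "snd c x \<in> V"
        using d by auto
      then have "x \<in> cinv c ` V"
        using c by (intro image_eqI[of _ _ "snd c x"]) auto
      then show "y \<in> ?L" using x by blast
    qed
  qed
  then show "open (snd d ` (cinv c ` V \<inter> fst d))"
    using continuous_open_preimage[OF smooth_on_imp_continuous_on[OF overlap_open[OF d c]
          transition_smooth[OF d c]] overlap_open[OF d c] V(1)] by simp
qed

lemma continuous_map_cinv:
  assumes "c \<in> A"
  shows "continuous_map (top_of_set (cimg c)) (mtop A) (cinv c)"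
  unfolding continuous_map_def
proof (intro conjI allI impI funcsetI)
  show "cinv c z \<in> topspace (mtop A)" if "z \<in> topspace (top_of_set (cimg c))" for z
    using that assms inv_into_into[of z "snd c" "fst c"]
    unfolding topspace_mtop carrier_of_def by auto
  fix U assume "openin (mtop A) U"
  then have "open (snd c ` (U \<inter> fst c))"
    using assms openin_mtop by blast
  moreover have "{z \<in> topspace (top_of_set (cimg c)). cinv c z \<in> U} = snd c ` (U \<inter> fst c)"
    using assms by auto
  ultimately show "openin (top_of_set (cimg c)) {z \<in> topspace (top_of_set (cimg c)). cinv c z \<in> U}"
    using chart_image_open[OF assms] by (auto simp: openin_open_eq)
qed

lemma smooth_fun_iff_k_diff: "smooth_fun A f \<longleftrightarrow> (\<forall>c\<in>A. \<forall>k. k_diff k (cimg c) (\<lambda>z. f (cinv c z)))"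
  unfolding smooth_fun_def
  by (intro ball_cong) (simp_all add: smooth_on_iff_k_diff[OF chart_image_open] comp_def)

text \<open>
  A Euclidean bump in a chart around \<open>x\<close>, extended by \<open>0\<close>. This is where the Hausdorff property enters: the compact support \<open>K\<close>
  is then closed, so every other chart is covered by two open sets, the overlap with the first chart (where
  \<open>\<rho>\<close> is the bump composed with a transition map) and the complement of \<open>K\<close> (where \<open>\<rho> = 0\<close>).
\<close>

lemma smooth_bump_at_point:
  assumes haus: "Hausdorff_space (mtop A)" and W: "openin (mtop A) W" and "x \<in> W"
  obtains V K \<rho> where "openin (mtop A) V" "x \<in> V" "compactin (mtop A) K" "K \<subseteq> W"
    "smooth_fun A \<rho>" "\<And>y. y \<in> V \<Longrightarrow> \<rho> y = 1" "\<And>y. y \<notin> K \<Longrightarrow> \<rho> y = 0"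
proof -
  obtain c where c: "c \<in> A" "x \<in> fst c"
    using assms openin_mtop[of W] unfolding carrier_of_def by blast
  define a where "a = snd c x"
  have "open (snd c ` (W \<inter> fst c))" "a \<in> snd c ` (W \<inter> fst c)"
    using W openin_mtop c \<open>x \<in> W\<close> a_def by auto
  then obtain r where r: "r > 0" "cball a r \<subseteq> snd c ` (W \<inter> fst c)"
    using open_contains_cball by blast
  define b where "b = (\<lambda>z. smooth_step (2 - ((z - a) \<bullet> (z - a)) * (2 / r\<^sup>2)))"
  define \<rho> where "\<rho> = (\<lambda>y. if y \<in> fst c then b (snd c y) else 0)"
  define K where "K = cinv c ` cball a r"
  have b0: "b z = 0" if "z \<notin> cball a r" for z
  proof -
    have "r\<^sup>2 \<le> (norm (z - a))\<^sup>2"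
      using that r(1) by (intro power_mono) (auto simp: dist_norm norm_minus_commute)
    then show ?thesis
      unfolding b_def using r(1)
      by (intro smooth_step_eq_0) (simp add: dot_square_norm field_simps)
  qed
  have b1: "b z = 1" if "z \<in> ball a (r / 2)" for z
  proof -
    have "(norm (z - a))\<^sup>2 \<le> (r / 2)\<^sup>2"
      using that by (intro power_mono) (auto simp: dist_norm norm_minus_commute)
    also have "\<dots> \<le> r\<^sup>2 / 2"
      by (simp add: power_divide)
    finally show ?thesis
      unfolding b_def using r(1)
      by (intro smooth_step_eq_1) (simp add: dot_square_norm field_simps)
  qed
  have cb: "cball a r \<subseteq> cimg c" using r(2) by blast
  have K: "compactin (mtop A) K"
    unfolding K_def using cb
    by (intro image_compactin[OF _ continuous_map_cinv[OF c(1)]]) (simp add: compactin_subtopology)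
  have \<rho>0: "\<rho> y = 0" if "y \<notin> K" for y
  proof (cases "y \<in> fst c")
    case True
    then have "snd c y \<notin> cball a r"
      using that c(1) unfolding K_def by (metis cinv_chart imageI)
    then show ?thesis by (simp add: \<rho>_def b0)
  qed (simp add: \<rho>_def)
  have "k_diff k (cimg d) (\<lambda>z. \<rho> (cinv d z))" if d: "d \<in> A" for d k
  proof -
    let ?S = "snd d ` (fst d \<inter> fst c)" and ?T = "snd d ` ((carrier_of A - K) \<inter> fst d)"
    have "openin (mtop A) (carrier_of A - K)"
      using compactin_imp_closedin[OF haus K] topspace_mtop by (metis openin_diff openin_topspace)
    then have oT: "open ?T" using d openin_mtop by blast
    have oS: "open ?S" by (rule overlap_open[OF d c(1)])
    have "k_diff k ?S (\<lambda>z. (snd c \<circ> cinv d) z)"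
      using transition_smooth[OF d c(1)] by (simp add: smooth_on_iff_k_diff[OF oS] comp_def)
    then have "k_diff k ?S (\<lambda>z. b ((snd c \<circ> cinv d) z))"
      unfolding b_def by (rule k_diff_compose[OF oS subset_UNIV _ k_diff_bump])
    moreover have "k_diff k ?S (\<lambda>z. \<rho> (cinv d z)) \<longleftrightarrow> k_diff k ?S (\<lambda>z. b ((snd c \<circ> cinv d) z))"
      by (rule k_diff_cong[OF oS]) (use d in \<open>auto simp: \<rho>_def\<close>)
    ultimately have S: "k_diff k ?S (\<lambda>z. \<rho> (cinv d z))"
      by blast
    have "k_diff k ?T (\<lambda>z. \<rho> (cinv d z)) \<longleftrightarrow> k_diff k ?T (\<lambda>_. 0::real)"
      by (rule k_diff_cong[OF oT]) (use d \<rho>0 in auto)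
    then have T: "k_diff k ?T (\<lambda>z. \<rho> (cinv d z))"
      using k_diff_const[OF oT] by simp
    have "K \<subseteq> fst c"
      unfolding K_def using cb inv_into_into[of _ "snd c" "fst c"] by blast
    then have "cimg d \<subseteq> ?S \<union> ?T"
      using d unfolding carrier_of_def by blast
    then show ?thesis
      by (rule k_diff_subset[OF k_diff_Un[OF S T]])
  qed
  then have \<rho>: "smooth_fun A \<rho>"
    using smooth_fun_iff_k_diff by blast
  have V: "openin (mtop A) (cinv c ` ball a (r / 2))"
    using cb r(1) by (intro open_cinv_image c) (auto simp: subset_iff)
  have xV: "x \<in> cinv c ` ball a (r / 2)"
    using c r(1) by (intro image_eqI[of _ _ a]) (auto simp: a_def)
  have KW: "K \<subseteq> W"
  proof
    fix y assume "y \<in> K"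
    then obtain x where "x \<in> W" "x \<in> fst c" "y = cinv c (snd c x)"
      using r(2) unfolding K_def by blast
    then show "y \<in> W" using c(1) by simp
  qed
  have \<rho>1: "\<rho> y = 1" if y: "y \<in> cinv c ` ball a (r / 2)" for y
  proof -
    obtain z where z: "z \<in> ball a (r / 2)" "y = cinv c z" using y by blast
    then have "z \<in> cimg c" using cb r(1) by (auto simp: subset_iff)
    then show ?thesis
      using z b1 by (simp add: \<rho>_def inv_into_into f_inv_into_f)
  qed
  show thesis
    by (rule that[OF V xV K KW \<rho> \<rho>1 \<rho>0])
qed

text \<open>
  Finitely many bumps suffice by compactness. The function \<open>1 - \<Prod>\<^sub>x (1 - \<rho>\<^sub>x)\<close> equals \<open>1\<close> as soon as
  one of them does and \<open>0\<close> where all of them vanish.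
\<close>

lemma smooth_separation:
  assumes haus: "Hausdorff_space (mtop A)" and X: "compactin (mtop A) X"
    and W: "openin (mtop A) W" "X \<subseteq> W"
  obtains f K where "smooth_fun A f" "compactin (mtop A) K" "K \<subseteq> W"
    "\<And>y. y \<in> X \<Longrightarrow> f y = 1" "\<And>y. y \<notin> K \<Longrightarrow> f y = 0"
proof -
  let ?P = "\<lambda>x V K \<rho>. openin (mtop A) V \<and> x \<in> V \<and> compactin (mtop A) K \<and> K \<subseteq> W \<and>
      smooth_fun A \<rho> \<and> (\<forall>y\<in>V. \<rho> y = 1) \<and> (\<forall>y. y \<notin> K \<longrightarrow> \<rho> y = 0)"
  have "\<exists>V K \<rho>. ?P x V K \<rho>" if x: "x \<in> X" for x
  proof -
    have "x \<in> W" using x W(2) by blast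
    from smooth_bump_at_point[OF haus W(1) this] show ?thesis by metis
  qed
  then have "\<forall>x\<in>X. \<exists>V K \<rho>. ?P x V K \<rho>" by blast
  then obtain V K \<rho> where P: "\<forall>x\<in>X. ?P x (V x) (K x) (\<rho> x)" by metis
  have V: "\<And>x. x \<in> X \<Longrightarrow> openin (mtop A) (V x)" "\<And>x. x \<in> X \<Longrightarrow> x \<in> V x"
    and K: "\<And>x. x \<in> X \<Longrightarrow> compactin (mtop A) (K x)" "\<And>x. x \<in> X \<Longrightarrow> K x \<subseteq> W"
    and \<rho>: "\<And>x. x \<in> X \<Longrightarrow> smooth_fun A (\<rho> x)"
      "\<And>x y. x \<in> X \<Longrightarrow> y \<in> V x \<Longrightarrow> \<rho> x y = 1" "\<And>x y. x \<in> X \<Longrightarrow> y \<notin> K x \<Longrightarrow> \<rho> x y = 0"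
    using P by auto
  have "\<forall>U\<in>V ` X. openin (mtop A) U" "X \<subseteq> \<Union>(V ` X)"
    using V by auto
  then obtain \<F> where "finite \<F>" "\<F> \<subseteq> V ` X" "X \<subseteq> \<Union>\<F>"
    using X unfolding compactin_def by meson
  then obtain F where F: "finite F" "F \<subseteq> X" "X \<subseteq> (\<Union>x\<in>F. V x)"
    by (metis finite_subset_image)
  define f where "f = (\<lambda>y. 1 - (\<Prod>x\<in>F. 1 - \<rho> x y))"
  have "k_diff k (cimg c) (\<lambda>z. f (cinv c z))" if "c \<in> A" for c k
    unfolding f_def using F(1,2) \<rho>(1) that smooth_fun_iff_k_diff
    by (intro k_diff_diff k_diff_const k_diff_prod chart_image_open) auto
  then have f: "smooth_fun A f"
    using smooth_fun_iff_k_diff by blast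
  have KF: "compactin (mtop A) (\<Union>x\<in>F. K x)"
    using F K(1) by (intro compactin_Union) auto
  have KW: "(\<Union>x\<in>F. K x) \<subseteq> W"
    using F(2) K(2) by blast
  have f1: "f y = 1" if y: "y \<in> X" for y
  proof -
    obtain x where "x \<in> F" "y \<in> V x" using y F(3) by blast
    then have "(\<Prod>x\<in>F. 1 - \<rho> x y) = 0"
      using F(1,2) \<rho>(2) by (intro prod_zero bexI[of _ x]) auto
    then show ?thesis by (simp add: f_def)
  qed
  have f0: "f y = 0" if y: "y \<notin> (\<Union>x\<in>F. K x)" for y
  proof -
    have "(\<Prod>x\<in>F. 1 - \<rho> x y) = 1"
      using y F(2) \<rho>(3) by (intro prod.neutral) auto
    then show ?thesis by (simp add: f_def)
  qed
  show thesis
    by (rule that[OF f KF KW f1 f0])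
qed

end


section \<open>Derivatives of transition maps\<close>

context
  fixes A :: "('m, 'e::euclidean_space) chart set"
  assumes A: "smooth_atlas A"
begin

lemma transition_has_derivative:
  assumes "c \<in> A" "d \<in> A" "q \<in> fst c \<inter> fst d"
  shows "((snd d \<circ> cinv c) has_derivative dtrans c d q) (at (snd c q))"
proof -
  have "k_diff (Suc 0) (snd c ` (fst c \<inter> fst d)) (snd d \<circ> cinv c)"
    using transition_smooth[OF A assms(1,2)] smooth_on_iff_k_diff[OF overlap_open[OF A assms(1,2)]] by blast
  from k_diff_Suc_has_derivative[OF this imageI[OF assms(3)]] show ?thesis
    unfolding dtrans_def .
qed

lemma linear_dtrans:
  "c \<in> A \<Longrightarrow> d \<in> A \<Longrightarrow> q \<in> fst c \<inter> fst d \<Longrightarrow> linear (dtrans c d q)"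
  using transition_has_derivative has_derivative_linear by blast

lemma dtrans_self:
  assumes "c \<in> A" "q \<in> fst c"
  shows "dtrans c c q = (\<lambda>v. v)"
proof -
  have "((\<lambda>z. z) has_derivative (\<lambda>v. v)) (at (snd c q))"
    by simp
  then have "((snd c \<circ> cinv c) has_derivative (\<lambda>v. v)) (at (snd c q))"
    by (rule has_derivative_transform_within_open[OF _ chart_image_open[OF A assms(1)]])
      (use assms(2) in \<open>auto simp: f_inv_into_f\<close>)
  then show ?thesis
    using transition_has_derivative[of c c q] assms has_derivative_unique by blast
qed

text \<open>
  The chain rule for the transition from \<open>c\<close> to \<open>e\<close>, factored through \<open>d\<close> near \<open>snd c q\<close>.
\<close>

lemma dtrans_cocycle:
  assumes "c \<in> A" "d \<in> A" "e \<in> A" and q: "q \<in> fst c" "q \<in> fst d" "q \<in> fst e"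
  shows "dtrans d e q (dtrans c d q v) = dtrans c e q v"
proof -
  let ?U = "snd c ` (fst c \<inter> fst d)"
  have "snd d q = (snd d \<circ> cinv c) (snd c q)"
    using assms by (simp add: cinv_chart[OF A])
  then have "((snd e \<circ> cinv d) has_derivative dtrans d e q) (at ((snd d \<circ> cinv c) (snd c q)))"
    using transition_has_derivative[of d e q] assms by simp
  from has_derivative_compose[OF transition_has_derivative this]
  have "((\<lambda>z. (snd e \<circ> cinv d) ((snd d \<circ> cinv c) z)) has_derivative
      (\<lambda>v. dtrans d e q (dtrans c d q v))) (at (snd c q))"
    using assms by blast
  moreover have "open ?U"
    using assms overlap_open[OF A] by blast
  moreover have "snd c q \<in> ?U"
    using assms by (auto simp: cinv_chart[OF A])
  moreover have "(snd e \<circ> cinv d) ((snd d \<circ> cinv c) z) = (snd e \<circ> cinv c) z" if "z \<in> ?U" for z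
    using that assms by (auto simp: cinv_chart[OF A])
  ultimately have "((snd e \<circ> cinv c) has_derivative (\<lambda>v. dtrans d e q (dtrans c d q v))) (at (snd c q))"
    by (rule has_derivative_transform_within_open)
  then have "(\<lambda>v. dtrans d e q (dtrans c d q v)) = dtrans c e q"
    using transition_has_derivative[of c e q] assms has_derivative_unique by blast
  then show ?thesis by (rule fun_cong)
qed

end


section \<open>The cotangent bundle as a Hausdorff manifold\<close>

abbreviation cot_chart :: "('m, 'n::finite) base_chart set \<Rightarrow> ('m, 'n) base_chart \<Rightarrow> ('m, 'n) cot_chart"
  where "cot_chart A c \<equiv> ({x \<in> cotangent A. fst x \<in> fst c}, \<lambda>x. (snd c (fst x), snd x c))"

lemma cot_atlas_eq: "cot_atlas A = cot_chart A ` A"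
  unfolding cot_atlas_def ..

lemma cotangent_iff:
  "x \<in> cotangent A \<longleftrightarrow> fst x \<in> carrier_of A \<and>
    (\<forall>c. \<not> (c \<in> A \<and> fst x \<in> fst c) \<longrightarrow> snd x c = 0) \<and>
    (\<forall>c\<in>A. \<forall>d\<in>A. fst x \<in> fst c \<inter> fst d \<longrightarrow>
      (\<forall>v. snd x c \<bullet> v = snd x d \<bullet> dtrans c d (fst x) v))"
  unfolding cotangent_def by (simp add: case_prod_beta')

lemma carrier_of_cot_atlas: "carrier_of (cot_atlas A) = cotangent A"
proof -
  have "fst x \<in> carrier_of A" if "x \<in> cotangent A" for x
    using that unfolding cotangent_iff by (rule conjunct1)
  then show ?thesis
    unfolding carrier_of_def cot_atlas_eq by auto
qed

context
  fixes A :: "('m, 'n::finite) base_chart set"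
  assumes A: "smooth_atlas A"
begin

lemma covector_transition:
  assumes "x \<in> cotangent A" "c \<in> A" "d \<in> A" "fst x \<in> fst c" "fst x \<in> fst d"
  shows "snd x d = adjoint (dtrans d c (fst x)) (snd x c)"
proof -
  have lin: "linear (dtrans d c (fst x))"
    using assms linear_dtrans[OF A] by blast
  have "v \<bullet> snd x d = v \<bullet> adjoint (dtrans d c (fst x)) (snd x c)" for v
  proof -
    have "snd x d \<bullet> v = snd x c \<bullet> dtrans d c (fst x) v"
      using assms unfolding cotangent_iff by blast
    then show ?thesis
      unfolding adjoint_works[OF lin] inner_commute[of v] inner_commute[of _ "snd x c"] .
  qed
  then show ?thesis
    by (metis vector_eq_ldot)
qed

text \<open>
  The coordinates of a covector in one chart may be prescribed: the others are forced to be its pullbacks, and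
  the cocycle property of \<open>dtrans\<close> says that these are compatible with each other.
\<close>

lemma covector_exists:
  assumes c: "c \<in> A" "q \<in> fst c"
  obtains x where "x \<in> cotangent A" "fst x = q" "snd x c = p"
proof -
  define \<xi> where "\<xi> = (\<lambda>d. if d \<in> A \<and> q \<in> fst d then adjoint (dtrans d c q) p else 0)"
  have \<xi>: "\<xi> d \<bullet> v = p \<bullet> dtrans d c q v" if "d \<in> A" "q \<in> fst d" for d v
  proof -
    have "linear (dtrans d c q)" using linear_dtrans[OF A] that c by blast
    then show ?thesis
      using that by (simp add: \<xi>_def adjoint_works inner_commute[of _ v] inner_commute[of p])
  qed
  have outside: "\<xi> d = 0" if "\<not> (d \<in> A \<and> q \<in> fst d)" for d
    using that by (simp only: \<xi>_def if_False)
  have "\<xi> d \<bullet> v = \<xi> e \<bullet> dtrans d e q v" if "d \<in> A" "e \<in> A" "q \<in> fst d \<inter> fst e" for d e v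
    using that c \<xi> dtrans_cocycle[OF A, of d e c q v] by simp
  then have "(q, \<xi>) \<in> cotangent A"
    using c outside unfolding cotangent_iff carrier_of_def fst_conv snd_conv by blast
  moreover have "\<xi> c = p"
    using \<xi>[OF c] dtrans_self[OF A c] by (metis vector_eq_rdot)
  ultimately show thesis
    using that[of "(q, \<xi>)"] by simp
qed

lemma cot_chart_image:
  assumes "c \<in> A" "U \<subseteq> fst c"
  shows "snd (cot_chart A c) ` {x \<in> cotangent A. fst x \<in> U} = (snd c ` U) \<times> UNIV"
proof
  show "(snd c ` U) \<times> UNIV \<subseteq> snd (cot_chart A c) ` {x \<in> cotangent A. fst x \<in> U}"
  proof (clarify)
    fix q p assume q: "q \<in> U"
    obtain x where "x \<in> cotangent A" "fst x = q" "snd x c = p"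
      using covector_exists[OF assms(1), of q p] q assms(2) by blast
    then show "(snd c q, p) \<in> snd (cot_chart A c) ` {x \<in> cotangent A. fst x \<in> U}"
      using q by (intro image_eqI[of _ _ x]) auto
  qed
qed auto

lemma cot_chart_inj_on:
  assumes "c \<in> A"
  shows "inj_on (snd (cot_chart A c)) (fst (cot_chart A c))"
proof (rule inj_onI)
  fix x y assume x: "x \<in> fst (cot_chart A c)" and y: "y \<in> fst (cot_chart A c)"
    and eq: "snd (cot_chart A c) x = snd (cot_chart A c) y"
  have q: "fst x = fst y"
    using x y eq chart_inj_on[OF A assms] by (auto dest: inj_onD)
  have "snd x d = snd y d" for d
  proof (cases "d \<in> A \<and> fst x \<in> fst d")
    case True
    then show ?thesis
      using covector_transition[of x c d] covector_transition[of y c d] x y eq q assms by auto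
  next
    case False
    moreover have "snd z d = 0" if "z \<in> cotangent A" "\<not> (d \<in> A \<and> fst z \<in> fst d)" for z
      using that unfolding cotangent_iff by blast
    ultimately show ?thesis
      using x y q by simp
  qed
  then show "x = y" using q by (simp add: prod_eq_iff fun_eq_iff)
qed

lemma cot_overlap:
  "fst (cot_chart A c) \<inter> fst (cot_chart A d) = {x \<in> cotangent A. fst x \<in> fst c \<inter> fst d}"
  by auto

text \<open>
  In coordinates the transition is \<open>(z, p) \<mapsto> (\<tau> z, (D\<sigma> (\<tau> z))\<^sup>T p)\<close>, where \<open>\<tau>\<close> is the transition map of the base and
  \<open>\<sigma>\<close> its inverse. Taking the derivative of \<open>\<sigma>\<close> at \<open>\<tau> z\<close> avoids inverting the derivative of \<open>\<tau>\<close>, and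
  writing the transpose in a basis (the map \<open>?F\<close> below) exhibits the result as built from smooth functions by sums, products
  and compositions.
\<close>

lemma cot_transition_smooth:
  assumes c: "c \<in> A" and d: "d \<in> A"
  shows "smooth_on (snd (cot_chart A c) ` (fst (cot_chart A c) \<inter> fst (cot_chart A d)))
    (snd (cot_chart A d) \<circ> cinv (cot_chart A c))"
proof -
  let ?S = "snd c ` (fst c \<inter> fst d)" and ?T = "snd d ` (fst d \<inter> fst c)"
  let ?\<tau> = "snd d \<circ> cinv c" and ?\<sigma> = "snd c \<circ> cinv d"
  let ?F = "\<lambda>z. (?\<tau> (fst z), \<Sum>b\<in>Basis. (snd z \<bullet> frechet_derivative ?\<sigma> (at (?\<tau> (fst z))) b) *\<^sub>R b)"
  have im: "snd (cot_chart A c) ` (fst (cot_chart A c) \<inter> fst (cot_chart A d)) = ?S \<times> UNIV"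
    unfolding cot_overlap by (rule cot_chart_image[OF c]) blast
  have oS: "open ?S" and oT: "open ?T" and o: "open (?S \<times> (UNIV :: (real ^ 'n) set))"
    using overlap_open[OF A c d] overlap_open[OF A d c] by (simp_all add: open_Times)
  have eq: "(snd (cot_chart A d) \<circ> cinv (cot_chart A c)) z = ?F z" if z: "z \<in> ?S \<times> UNIV" for z
  proof -
    obtain x where x: "x \<in> cotangent A" "fst x \<in> fst c" "fst x \<in> fst d" "z = snd (cot_chart A c) x"
      using z unfolding im[symmetric] by auto
    have lin: "linear (dtrans d c (fst x))" using linear_dtrans[OF A d c] x by blast
    have "cinv (cot_chart A c) z = x"
      unfolding x(4) using x(1,2) by (intro inv_into_f_f cot_chart_inj_on c) auto
    then have "(snd (cot_chart A d) \<circ> cinv (cot_chart A c)) z = (snd d (fst x), snd x d)"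
      by simp
    moreover have "?\<tau> (fst z) = snd d (fst x)"
      using x c by (simp add: cinv_chart[OF A])
    moreover have "snd x d = (\<Sum>b\<in>Basis. (snd z \<bullet> dtrans d c (fst x) b) *\<^sub>R b)"
    proof -
      have "snd x d \<bullet> b = snd z \<bullet> dtrans d c (fst x) b" for b
        unfolding covector_transition[OF x(1) c d x(2,3)] using adjoint_works[OF lin] x(4)
        by (simp add: inner_commute[of _ b] inner_commute[of "snd x c"])
      then show ?thesis
        by (metis (no_types, lifting) euclidean_representation sum.cong)
    qed
    ultimately show ?thesis by (simp add: dtrans_def)
  qed
  have "k_diff k (?S \<times> UNIV) ?F" for k
  proof -
    \<comment> \<open>One more derivative of \<open>\<sigma>\<close> than of \<open>\<tau>\<close> is spent, since \<open>?F\<close> contains the derivative of \<open>\<sigma>\<close>.\<close>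
    have \<tau>: "k_diff k ?S ?\<tau>" and \<sigma>: "k_diff (Suc k) ?T ?\<sigma>"
      using transition_smooth[OF A] c d smooth_on_iff_k_diff oS oT by blast+
    have base: "k_diff k (?S \<times> UNIV) (\<lambda>z :: 'n phase. ?\<tau> (fst z))"
      by (rule k_diff_compose[OF o _ k_diff_bounded_linear[OF o bounded_linear_fst] \<tau>]) auto
    have fibre: "k_diff k (?S \<times> UNIV) (\<lambda>z :: 'n phase. frechet_derivative ?\<sigma> (at (?\<tau> (fst z))) b)" for b
    proof (rule k_diff_compose[OF o _ base])
      show "k_diff k ?T (\<lambda>y. frechet_derivative ?\<sigma> (at y) b)"
        using \<sigma> by simp
      show "(\<lambda>z :: 'n phase. ?\<tau> (fst z)) ` (?S \<times> UNIV) \<subseteq> ?T"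
        using c by (auto simp: cinv_chart[OF A])
    qed
    show ?thesis
      by (intro k_diff_Pair base fibre k_diff_sum k_diff_scaleR k_diff_inner k_diff_const
          k_diff_bounded_linear[OF o bounded_linear_snd] o finite_Basis)
  qed
  moreover have "k_diff k (?S \<times> UNIV) (snd (cot_chart A d) \<circ> cinv (cot_chart A c)) \<longleftrightarrow>
      k_diff k (?S \<times> UNIV) ?F" for k
    by (rule k_diff_cong[OF o eq])
  ultimately show ?thesis
    unfolding im smooth_on_iff_k_diff[OF o] by blast
qed

theorem smooth_atlas_cot_atlas: "smooth_atlas (cot_atlas A)"
proof -
  have "open (cimg (cot_chart A c))" if "c \<in> A" for c
    using cot_chart_image[OF that subset_refl] chart_image_open[OF A that]
    by (simp add: open_Times)
  moreover have "open (snd (cot_chart A c) ` (fst (cot_chart A c) \<inter> fst (cot_chart A d)))"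
    if "c \<in> A" "d \<in> A" for c d
    unfolding cot_overlap cot_chart_image[OF that(1) Int_lower1]
    using overlap_open[OF A that] by (simp add: open_Times)
  ultimately show ?thesis
    unfolding smooth_atlas_def cot_atlas_eq ball_simps
    using cot_chart_inj_on cot_transition_smooth by blast
qed

lemma openin_cotangent_over:
  assumes "openin (mtop A) U"
  shows "openin (mtop (cot_atlas A)) {x \<in> cotangent A. fst x \<in> U}"
proof -
  have "open (snd (cot_chart A c) ` ({x \<in> cotangent A. fst x \<in> U} \<inter> fst (cot_chart A c)))"
    if c: "c \<in> A" for c
  proof -
    have "{x \<in> cotangent A. fst x \<in> U} \<inter> fst (cot_chart A c) = {x \<in> cotangent A. fst x \<in> U \<inter> fst c}"
      by auto
    then show ?thesis
      using cot_chart_image[OF c Int_lower2] assms openin_mtop[OF A] c by (simp add: open_Times)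
  qed
  then show ?thesis
    unfolding openin_mtop[OF smooth_atlas_cot_atlas] carrier_of_cot_atlas
    unfolding cot_atlas_eq ball_simps by blast
qed

text \<open>
  Covectors at different points are separated by preimages of disjoint open sets of the base; covectors at the
  same point lie in a common chart, where Euclidean space separates them.
\<close>

theorem Hausdorff_space_cot_atlas:
  assumes "Hausdorff_space (mtop A)"
  shows "Hausdorff_space (mtop (cot_atlas A))"
  unfolding Hausdorff_space_def topspace_mtop[OF smooth_atlas_cot_atlas] carrier_of_cot_atlas
proof (intro allI impI, elim conjE)
  fix x y assume x: "x \<in> cotangent A" and y: "y \<in> cotangent A" and "x \<noteq> y"
  show "\<exists>U V. openin (mtop (cot_atlas A)) U \<and> openin (mtop (cot_atlas A)) V \<and>
      x \<in> U \<and> y \<in> V \<and> disjnt U V"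
  proof (cases "fst x = fst y")
    case False
    have "fst x \<in> topspace (mtop A)" "fst y \<in> topspace (mtop A)"
      using x y unfolding topspace_mtop[OF A] cotangent_iff by auto
    then obtain U V where UV: "openin (mtop A) U" "openin (mtop A) V" "fst x \<in> U" "fst y \<in> V" "disjnt U V"
      using assms False unfolding Hausdorff_space_def by meson
    show ?thesis
    proof (intro exI conjI)
      show "openin (mtop (cot_atlas A)) {x \<in> cotangent A. fst x \<in> U}"
        by (rule openin_cotangent_over[OF UV(1)])
      show "openin (mtop (cot_atlas A)) {x \<in> cotangent A. fst x \<in> V}"
        by (rule openin_cotangent_over[OF UV(2)])
    qed (use x y UV(3-5) in \<open>auto simp: disjnt_def\<close>)
  next
    case True
    have "x \<in> carrier_of (cot_atlas A)"
      using x unfolding carrier_of_cot_atlas .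
    then obtain C where C: "C \<in> cot_atlas A" "x \<in> fst C"
      unfolding carrier_of_def by blast
    have yC: "y \<in> fst C"
      using C y True unfolding cot_atlas_eq by auto
    note cinv = cinv_chart[OF smooth_atlas_cot_atlas C(1)]
    have "snd C x \<noteq> snd C y"
    proof
      assume "snd C x = snd C y"
      then show False using cinv[OF C(2)] cinv[OF yC] \<open>x \<noteq> y\<close> by simp
    qed
    from hausdorff[OF this] obtain U V
      where UV: "open U" "open V" "snd C x \<in> U" "snd C y \<in> V" "U \<inter> V = {}"
      by (elim exE conjE) rule
    have op: "openin (mtop (cot_atlas A)) (cinv C ` (W \<inter> cimg C))" if "open W" for W
      using open_Int[OF that chart_image_open[OF smooth_atlas_cot_atlas C(1)]]
      by (rule open_cinv_image[OF smooth_atlas_cot_atlas C(1)]) (rule Int_lower2)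
    have chart: "snd C z \<in> W" if "z \<in> cinv C ` (W \<inter> cimg C)" for z W
      using that cinv by auto
    show ?thesis
    proof (intro exI conjI)
      show "openin (mtop (cot_atlas A)) (cinv C ` (U \<inter> cimg C))"
        "openin (mtop (cot_atlas A)) (cinv C ` (V \<inter> cimg C))"
        by (rule op[OF UV(1)], rule op[OF UV(2)])
      show "x \<in> cinv C ` (U \<inter> cimg C)"
        by (rule image_eqI[of _ _ "snd C x"]) (use cinv[OF C(2)] C(2) UV(3) in auto)
      show "y \<in> cinv C ` (V \<inter> cimg C)"
        by (rule image_eqI[of _ _ "snd C y"]) (use cinv[OF yC] yC UV(4) in auto)
      show "disjnt (cinv C ` (U \<inter> cimg C)) (cinv C ` (V \<inter> cimg C))"
        unfolding disjnt_def disjoint_iff using UV(5) chart by (meson disjoint_iff)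
    qed
  qed
qed

end


section \<open>Disjoint sets are not both superheavy\<close>

theorem proposition1p21:
  fixes A :: "('m, 'n::finite) base_chart set"
    and g :: "('m, 'n) base_chart \<Rightarrow> real ^ 'n \<Rightarrow> real ^ 'n \<Rightarrow> real ^ 'n \<Rightarrow> real"
    and X X' :: "('m, 'n) cotpoint set"
  assumes "closed_connected_manifold A"
    and "riemannian_metric A g"
    and "superheavy A g X"
    and "superheavy A g X'"
  shows "X \<inter> X' \<noteq> {}"
proof
  assume disj: "X \<inter> X' = {}"
  have A: "smooth_atlas A" and haus: "Hausdorff_space (mtop A)"
    using assms(1) unfolding closed_connected_manifold_def by auto
  have B: "smooth_atlas (cot_atlas A)" and hausB: "Hausdorff_space (mtop (cot_atlas A))"
    using smooth_atlas_cot_atlas[OF A] Hausdorff_space_cot_atlas[OF A haus] by auto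
  have X: "compactin (mtop (cot_atlas A)) X" and X': "compactin (mtop (cot_atlas A)) X'"
    using assms(3,4) unfolding superheavy_def by auto
  let ?W = "topspace (mtop (cot_atlas A)) - X"
  have W: "openin (mtop (cot_atlas A)) ?W"
    using compactin_imp_closedin[OF hausB X] by (rule openin_diff[OF openin_topspace])
  have "X' \<subseteq> ?W"
    using disj compactin_subset_topspace[OF X'] by blast
  then obtain f K where f: "smooth_fun (cot_atlas A) f" "compactin (mtop (cot_atlas A)) K" "K \<subseteq> ?W"
    "\<And>y. y \<in> X' \<Longrightarrow> f y = 1" "\<And>y. y \<notin> K \<Longrightarrow> f y = 0"
    using smooth_separation[OF B hausB X' W] by metis
  have cf: "compact_function A f"
    unfolding compact_function_def using f(1,2,5) by blast
  \<comment> \<open>\<open>K\<close> avoids \<open>X\<close>, so \<open>f\<close> vanishes on \<open>X\<close>.\<close>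
  have "zeta A g f = 0"
    using assms(3) cf f(3,5) unfolding superheavy_def by blast
  moreover have "zeta A g f = 1"
    using assms(4) cf f(4) unfolding superheavy_def by blast
  ultimately show False by simp
qed

end
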